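(* Let the manifold $X$ be a principal homogeneous space for a Lie group $G$ acting by $y=f(x,a)$, i.e. the graph of the action $X\times G\to X\times Y$, $(x,a)\mapsto(x,f(x,a))$, is an isomorphism, where $Y$ is a copy of $X$. Then the group parameters, regarded via the inverse of the graph as functions $a=\varphi(x,y)$ on $X\times Y$, are constants on $X\times Y$ for the reciprocal distribution of the infinitesimal action of $G$ on $X$: for every $\delta$ in this reciprocal distribution, extended to $X\times Y$, one has $\delta a^\tau=0$ for all $\tau=1,\dots,p$. The simplest example is that of a Lie group $G$ acting on itself.
   Context: $p=\dim G$, and $(a^1,\dots,a^p)$ are the parameters (local coordinates) of $G$. $\Theta=(\theta_1,\dots,\theta_p)$ are the infinitesimal generators of the action of $G$ on $X$. The reciprocal distribution $\Delta$ consists of the vector fields $\delta=\xi^i(x)\frac{\partial}{\partial x^i}$ on $X$ with $[\delta,\theta_\tau]=0$ for all $\tau$. Each such $\delta$ is extended to $X\times Y$ by $$\delta=\xi^i(x)\frac{\partial}{\partial x^i}+\xi^k(y)\frac{\partial}{\partial y^k},$$ where the $\xi^k(y)$ are the same component functions evaluated on the copy $Y$ of $X$. A function on $X\times Y$ is called a constant for $\Delta$ if it is killed by all the extended $\delta$.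
   Formalization: The manifold X is assumed connected; for disconnected X of positive dimension the claim fails, e.g. G = X = R × Z/2 with δ = d/dx on one component and 0 on the other, which commutes with the generator but gives δ(y − x) = ±1 across components. *)

theory Defs
  imports "HOL-Analysis.Analysis" "HOL-Algebra.Group_Action"
begin

section \<open>Smooth maps between Euclidean spaces\<close>

text \<open>For an open set \<open>S\<close> of a Euclidean space, \<open>Ck_on n S f\<close> is the usual notion of \<open>f\<close>
  being \<open>n\<close> times continuously differentiable on \<open>S\<close>; all derivatives are taken directionally, so
  that the type does not change in the recursion.\<close>

fun Ck_on :: "nat \<Rightarrow> 'a::real_normed_vector set \<Rightarrow> ('a \<Rightarrow> 'b::real_normed_vector) \<Rightarrow> bool" where
  "Ck_on 0 S f \<longleftrightarrow> continuous_on S f"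
| "Ck_on (Suc n) S f \<longleftrightarrow>
     (\<forall>x\<in>S. f differentiable (at x)) \<and> (\<forall>v. Ck_on n S (\<lambda>x. frechet_derivative f (at x) v))"

definition smooth_on :: "'a::real_normed_vector set \<Rightarrow> ('a \<Rightarrow> 'b::real_normed_vector) \<Rightarrow> bool" where
  "smooth_on S f \<longleftrightarrow> (\<forall>n. Ck_on n S f)"

section \<open>Smooth manifolds\<close>

text \<open>A chart is a pair of a domain and a coordinate map; the coordinate map is only meaningful on
  the domain. The dimension of the manifold is \<open>DIM('e)\<close> and the coordinates are the components
  along \<open>Basis\<close>.\<close>

type_synonym ('a, 'e) chart = "'a set \<times> ('a \<Rightarrow> 'e)"

abbreviation chart_inv :: "('a, 'e) chart \<Rightarrow> 'e \<Rightarrow> 'a" where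
  "chart_inv c \<equiv> inv_into (fst c) (snd c)"

record ('a, 'e) mfd =
  mtop :: "'a topology"
  atlas :: "('a, 'e) chart set"

definition smooth_manifold :: "('a, 'e::euclidean_space) mfd \<Rightarrow> bool" where
  "smooth_manifold M \<longleftrightarrow>
     Hausdorff_space (mtop M) \<and> second_countable (mtop M) \<and>
     (\<Union>c\<in>atlas M. fst c) = topspace (mtop M) \<and>
     (\<forall>c\<in>atlas M. openin (mtop M) (fst c) \<and> open (snd c ` fst c) \<and>
        homeomorphic_map (subtopology (mtop M) (fst c)) (top_of_set (snd c ` fst c)) (snd c)) \<and>
     (\<forall>c\<in>atlas M. \<forall>d\<in>atlas M.
        smooth_on (snd c ` (fst c \<inter> fst d)) (snd d \<circ> chart_inv c))"

definition prod_mfd :: "('a, 'e) mfd \<Rightarrow> ('b, 'f) mfd \<Rightarrow> ('a \<times> 'b, 'e \<times> 'f) mfd" where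
  "prod_mfd M N =
     \<lparr>mtop = prod_topology (mtop M) (mtop N),
      atlas = {(fst c \<times> fst d, map_prod (snd c) (snd d)) | c d. c \<in> atlas M \<and> d \<in> atlas N}\<rparr>"

definition smooth_map ::
  "('a, 'e::euclidean_space) mfd \<Rightarrow> ('b, 'f::euclidean_space) mfd \<Rightarrow> ('a \<Rightarrow> 'b) \<Rightarrow> bool" where
  "smooth_map M N F \<longleftrightarrow>
     continuous_map (mtop M) (mtop N) F \<and>
     (\<forall>c\<in>atlas M. \<forall>d\<in>atlas N.
        smooth_on (snd c ` {x \<in> fst c. F x \<in> fst d}) (snd d \<circ> F \<circ> chart_inv c))"

definition diffeomorphism ::
  "('a, 'e::euclidean_space) mfd \<Rightarrow> ('b, 'f::euclidean_space) mfd \<Rightarrow> ('a \<Rightarrow> 'b) \<Rightarrow> bool" where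
  "diffeomorphism M N F \<longleftrightarrow>
     bij_betw F (topspace (mtop M)) (topspace (mtop N)) \<and>
     smooth_map M N F \<and> smooth_map N M (inv_into (topspace (mtop M)) F)"

text \<open>Smoothness of a real function that is meaningful only on the open set \<open>W\<close> of \<open>M\<close>.\<close>

definition smooth_fun_on :: "('a, 'e::euclidean_space) mfd \<Rightarrow> 'a set \<Rightarrow> ('a \<Rightarrow> real) \<Rightarrow> bool" where
  "smooth_fun_on M W h \<longleftrightarrow>
     openin (mtop M) W \<and>
     (\<forall>c\<in>atlas M. smooth_on (snd c ` (fst c \<inter> W)) (h \<circ> chart_inv c))"

text \<open>The value at \<open>x\<close> of \<open>\<partial>h/\<partial>x\<^sup>i\<close> in the local coordinates given by the chart \<open>c\<close>.\<close>

definition coord_deriv ::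
  "('a, 'e::euclidean_space) chart \<Rightarrow> 'e \<Rightarrow> ('a \<Rightarrow> real) \<Rightarrow> 'a \<Rightarrow> real" where
  "coord_deriv c i h x = frechet_derivative (h \<circ> chart_inv c) (at (snd c x)) i"

section \<open>Vector fields\<close>

text \<open>A vector field is represented by the first-order differential operator \<open>\<xi>\<^sup>i(x) \<partial>/\<partial>x\<^sup>i\<close> it
  defines. The operator is applied to total functions, but its value at \<open>x\<close> is prescribed exactly
  for those functions that are smooth in a neighbourhood of \<open>x\<close>.\<close>

type_synonym 'a operator = "('a \<Rightarrow> real) \<Rightarrow> 'a \<Rightarrow> real"

definition vector_field :: "('a, 'e::euclidean_space) mfd \<Rightarrow> 'a operator \<Rightarrow> bool" where
  "vector_field M \<delta> \<longleftrightarrow>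
     (\<forall>c\<in>atlas M. \<exists>\<xi> :: 'e \<Rightarrow> 'e.
        smooth_on (snd c ` fst c) \<xi> \<and>
        (\<forall>W h. smooth_fun_on M W h \<longrightarrow>
           (\<forall>x \<in> fst c \<inter> W. \<delta> h x = (\<Sum>i\<in>Basis. (\<xi> (snd c x) \<bullet> i) * coord_deriv c i h x))))"

definition bracket :: "'a operator \<Rightarrow> 'a operator \<Rightarrow> 'a operator" where
  "bracket \<delta> \<eta> h x = \<delta> (\<eta> h) x - \<eta> (\<delta> h) x"

definition vf_commute ::
  "('a, 'e::euclidean_space) mfd \<Rightarrow> 'a operator \<Rightarrow> 'a operator \<Rightarrow> bool" where
  "vf_commute M \<delta> \<eta> \<longleftrightarrow> (\<forall>W h. smooth_fun_on M W h \<longrightarrow> (\<forall>x\<in>W. bracket \<delta> \<eta> h x = 0))"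

text \<open>The extension \<open>\<xi>\<^sup>i(x) \<partial>/\<partial>x\<^sup>i + \<xi>\<^sup>k(y) \<partial>/\<partial>y\<^sup>k\<close> of \<open>\<delta>\<close> to the product of two copies of
  the manifold.\<close>

definition extend_vf :: "'a operator \<Rightarrow> ('a \<times> 'a) operator" where
  "extend_vf \<delta> h = (\<lambda>(x, y). \<delta> (\<lambda>x'. h (x', y)) x + \<delta> (\<lambda>y'. h (x, y')) y)"

section \<open>Lie groups and their actions\<close>

definition lie_group :: "('g, 'm) monoid_scheme \<Rightarrow> ('g, 'p::euclidean_space) mfd \<Rightarrow> bool" where
  "lie_group G GM \<longleftrightarrow>
     group G \<and> smooth_manifold GM \<and> topspace (mtop GM) = carrier G \<and>
     smooth_map (prod_mfd GM GM) GM (\<lambda>(a, b). a \<otimes>\<^bsub>G\<^esub> b) \<and>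
     smooth_map GM GM (\<lambda>a. inv\<^bsub>G\<^esub> a)"

text \<open>The action \<open>y = f(x,a) = a x\<close> is a left action: \<open>f(f(x,a),b) = f(x,ba)\<close>.\<close>

definition lie_action ::
  "('g, 'm) monoid_scheme \<Rightarrow> ('g, 'p::euclidean_space) mfd \<Rightarrow> ('a, 'e::euclidean_space) mfd \<Rightarrow>
   ('a \<Rightarrow> 'g \<Rightarrow> 'a) \<Rightarrow> bool" where
  "lie_action G GM X f \<longleftrightarrow>
     group_action G (topspace (mtop X)) (\<lambda>a. restrict (\<lambda>x. f x a) (topspace (mtop X))) \<and>
     smooth_map (prod_mfd X GM) X (\<lambda>(x, a). f x a)"

definition action_graph :: "('a \<Rightarrow> 'g \<Rightarrow> 'a) \<Rightarrow> 'a \<times> 'g \<Rightarrow> 'a \<times> 'a" where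
  "action_graph f = (\<lambda>(x, a). (x, f x a))"

definition principal_homogeneous_space ::
  "('g, 'm) monoid_scheme \<Rightarrow> ('g, 'p::euclidean_space) mfd \<Rightarrow> ('a, 'e::euclidean_space) mfd \<Rightarrow>
   ('a \<Rightarrow> 'g \<Rightarrow> 'a) \<Rightarrow> bool" where
  "principal_homogeneous_space G GM X f \<longleftrightarrow>
     lie_action G GM X f \<and> diffeomorphism (prod_mfd X GM) (prod_mfd X X) (action_graph f)"

text \<open>The map \<open>(x,y) \<mapsto> a = \<phi>(x,y)\<close> read off from the inverse of the graph.\<close>

definition parameter_map ::
  "('g, 'm) monoid_scheme \<Rightarrow> ('a, 'e) mfd \<Rightarrow> ('a \<Rightarrow> 'g \<Rightarrow> 'a) \<Rightarrow> 'a \<times> 'a \<Rightarrow> 'g" where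
  "parameter_map G X f p = snd (inv_into (topspace (mtop X) \<times> carrier G) (action_graph f) p)"

text \<open>\<open>\<theta>\<^sub>\<tau> = \<partial>f\<^sup>i(x,a)/\<partial>a\<^sup>\<tau> \<partial>/\<partial>x\<^sup>i\<close> at the identity, as an operator
  \<open>h \<mapsto> \<partial>h(f(x,a))/\<partial>a\<^sup>\<tau>\<close>; the parameters are given by a chart \<open>c\<close> of the group around the
  identity.\<close>

definition inf_generator ::
  "('g, 'm) monoid_scheme \<Rightarrow> ('g, 'p::euclidean_space) chart \<Rightarrow> ('a \<Rightarrow> 'g \<Rightarrow> 'a) \<Rightarrow> 'p \<Rightarrow>
   'a operator" where
  "inf_generator G c f \<tau> h x = coord_deriv c \<tau> (\<lambda>a. h (f x a)) \<one>\<^bsub>G\<^esub>"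

definition reciprocal_distribution ::
  "('g, 'm) monoid_scheme \<Rightarrow> ('g, 'p::euclidean_space) chart \<Rightarrow> ('a, 'e::euclidean_space) mfd \<Rightarrow>
   ('a \<Rightarrow> 'g \<Rightarrow> 'a) \<Rightarrow> 'a operator set" where
  "reciprocal_distribution G c X f =
     {\<delta>. vector_field X \<delta> \<and> (\<forall>\<tau>\<in>Basis. vf_commute X \<delta> (inf_generator G c f \<tau>))}"

text \<open>\<open>h\<close> is a smooth function on the open set \<open>W\<close> of the product of two copies of \<open>X\<close>.\<close>

definition constant_for ::
  "('a, 'e::euclidean_space) mfd \<Rightarrow> 'a operator set \<Rightarrow> ('a \<times> 'a) set \<Rightarrow> ('a \<times> 'a \<Rightarrow> real) \<Rightarrow>
   bool" where
  "constant_for X \<Delta> W h \<longleftrightarrow>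
     smooth_fun_on (prod_mfd X X) W h \<and> (\<forall>\<delta>\<in>\<Delta>. \<forall>p\<in>W. extend_vf \<delta> h p = 0)"

end

theory Submission
  imports Defs
begin

text \<open>A vector field \<open>\<delta>\<close> commuting with the infinitesimal generators is invariant under every
  translation \<open>L\<^sub>a x = f x a\<close>: for a function \<open>h\<close> that is smooth near \<open>x\<close>, the number
  \<open>\<delta> (h \<circ> L\<^sub>b) (L\<^sub>b\<^sup>-\<^sup>1 x)\<close> has derivative \<open>\<delta> (\<theta> h) x - \<theta> (\<delta> h) x = 0\<close> in \<open>b\<close> at the identity, hence,
  after translation, everywhere, and \<open>G\<close> is connected because it is a continuous image of \<open>X\<close>
  under \<open>y \<mapsto> \<phi>(x, y)\<close>. By invariance the extension of \<open>\<delta>\<close> at \<open>(x, L\<^sub>a x)\<close> differentiates along the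
  graph of \<open>L\<^sub>a\<close>, on which \<open>\<phi>\<close> has the constant value \<open>a\<close>.\<close>

section \<open>Smooth maps between Euclidean spaces\<close>

text \<open>No flows and no exponential map occur. In coordinates \<open>k (f z s)\<close> is one
  function of a point and a group parameter; one of the two terms of the bracket is its mixed second
  derivative, and the symmetry of second derivatives takes the place of integrating the bracket. The
  base point is moved to \<open>f x (inv b)\<close> because \<open>h\<close> is then still evaluated
  at the image of that point under \<open>b\<close>, which is \<open>x\<close> again. So
  \<open>h\<close> has to be smooth near one point only, as is the case for group coordinates, which
  exist only on chart domains. A vector field acts on total functions, but its values are prescribed
  only where these are smooth, and functions that agree on the manifold may differ outside it. Hence
  smoothness is treated as a property of germs (\<open>smooth_at\<close>), and the dependence of a
  vector field on germs alone is proved (\<open>vector_field_cong\<close>) before functions are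
  exchanged under it.\<close>

lemma has_derivative_frechet:
  "f differentiable (at x) \<Longrightarrow> (f has_derivative frechet_derivative f (at x)) (at x)"
  by (simp add: frechet_derivative_works)

lemma frechet_derivative_eqI:
  "(f has_derivative f') (at x) \<Longrightarrow> frechet_derivative f (at x) v = f' v"
  by (metis frechet_derivative_at)

section \<open>Closure properties of \<open>Ck_on\<close> and \<open>smooth_on\<close>\<close>

lemma Ck_on_subset: "Ck_on n S f \<Longrightarrow> T \<subseteq> S \<Longrightarrow> Ck_on n T f"
  by (induction n arbitrary: f) (auto intro: continuous_on_subset)

lemma Ck_on_continuous: "Ck_on n S f \<Longrightarrow> continuous_on S f"
  by (cases n) (auto intro!: continuous_at_imp_continuous_on differentiable_imp_continuous_within)

lemma Ck_on_SucD: "Ck_on (Suc n) S f \<Longrightarrow> Ck_on n S f"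
proof (induction n arbitrary: f)
  case 0
  then show ?case using Ck_on_continuous by fastforce
next
  case (Suc n)
  then show ?case by (metis Ck_on.simps(2))
qed

text \<open>Openness of \<open>S\<close> is what lets the derivatives at points of \<open>S\<close>
  depend on the values in \<open>S\<close> alone.\<close>

lemma Ck_on_cong:
  assumes "Ck_on n S f" "open S" "\<And>x. x \<in> S \<Longrightarrow> f x = g x"
  shows "Ck_on n S g"
  using assms
proof (induction n arbitrary: f g)
  case 0
  then show ?case by (metis Ck_on.simps(1) continuous_on_cong)
next
  case (Suc n)
  have d: "(g has_derivative frechet_derivative f (at x)) (at x)" if "x \<in> S" for x
    using Suc.prems that
    by (auto intro!: has_derivative_transform_within_open[OF has_derivative_frechet])
  have "Ck_on n S (\<lambda>x. frechet_derivative g (at x) v)" for v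
    by (rule Suc.IH[of "\<lambda>x. frechet_derivative f (at x) v"])
      (use Suc.prems in \<open>simp_all add: frechet_derivative_eqI[OF d]\<close>)
  then show ?case using d by (auto simp: differentiable_def)
qed

lemma Ck_on_local:
  assumes "\<And>p. p \<in> S \<Longrightarrow> \<exists>U. open U \<and> p \<in> U \<and> Ck_on n U f"
  shows "Ck_on n S f"
  using assms
proof (induction n arbitrary: f)
  case 0
  then show ?case
    by (auto intro!: continuous_at_imp_continuous_on) (metis continuous_on_eq_continuous_at)
next
  case (Suc n)
  show ?case
    unfolding Ck_on.simps
  proof (intro conjI ballI allI)
    show "f differentiable at x" if "x \<in> S" for x using Suc.prems[OF that] by auto
    show "Ck_on n S (\<lambda>x. frechet_derivative f (at x) v)" for v
      by (rule Suc.IH) (metis Ck_on.simps(2) Suc.prems)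
  qed
qed

lemma Ck_on_const: "Ck_on n S (\<lambda>x. c)"
  by (induction n arbitrary: c) auto

lemma Ck_on_linear: assumes "bounded_linear f" shows "Ck_on n S f"
proof (cases n)
  case 0
  then show ?thesis using assms by (auto intro: linear_continuous_on)
next
  case (Suc m)
  have d: "(f has_derivative f) (at x)" for x
    using assms by (simp add: bounded_linear_imp_has_derivative)
  then have "frechet_derivative f (at x) = f" for x by (metis frechet_derivative_at)
  then show ?thesis using d by (auto simp: Suc differentiable_def Ck_on_const)
qed

lemma Ck_on_add:
  assumes "Ck_on n S f" "Ck_on n S g" "open S"
  shows "Ck_on n S (\<lambda>x. f x + g x)"
  using assms(1,2)
proof (induction n arbitrary: f g)
  case 0
  then show ?case by (auto intro: continuous_intros)
next
  case (Suc n)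
  have d: "((\<lambda>x. f x + g x) has_derivative
      (\<lambda>v. frechet_derivative f (at x) v + frechet_derivative g (at x) v)) (at x)"
    if "x \<in> S" for x
    using Suc.prems that by (auto intro!: has_derivative_add has_derivative_frechet)
  have "Ck_on n S (\<lambda>x. frechet_derivative (\<lambda>x. f x + g x) (at x) v)" for v
    by (rule Ck_on_cong[OF _ assms(3)], rule Suc.IH)
      (use Suc.prems in \<open>simp_all add: frechet_derivative_eqI[OF d]\<close>)
  then show ?case using d by (auto simp: differentiable_def)
qed

lemma Ck_on_sum:
  assumes "\<And>i. i \<in> I \<Longrightarrow> Ck_on n S (f i)" "open S"
  shows "Ck_on n S (\<lambda>x. \<Sum>i\<in>I. f i x)"
  using assms by (induction I rule: infinite_finite_induct) (auto intro: Ck_on_const Ck_on_add)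

lemma Ck_on_bilinear:
  assumes "bounded_bilinear pr" "Ck_on n S f" "Ck_on n S g" "open S"
  shows "Ck_on n S (\<lambda>x. pr (f x) (g x))"
  using assms(2,3)
proof (induction n arbitrary: f g)
  case 0
  then show ?case using assms(1) by (auto intro: bounded_bilinear.continuous_on)
next
  case (Suc n)
  have d: "((\<lambda>x. pr (f x) (g x)) has_derivative
      (\<lambda>v. pr (f x) (frechet_derivative g (at x) v) + pr (frechet_derivative f (at x) v) (g x)))
      (at x)" if "x \<in> S" for x
    using Suc.prems that
    by (auto intro!: bounded_bilinear.FDERIV[OF assms(1)] has_derivative_frechet)
  have "Ck_on n S (\<lambda>x. frechet_derivative (\<lambda>x. pr (f x) (g x)) (at x) v)" for v
  proof (rule Ck_on_cong[OF _ assms(4)])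
    show "Ck_on n S (\<lambda>x. pr (f x) (frechet_derivative g (at x) v)
        + pr (frechet_derivative f (at x) v) (g x))"
      by (intro Ck_on_add Suc.IH assms(4)) (use Suc.prems Ck_on_SucD in auto)
  qed (simp add: frechet_derivative_eqI[OF d])
  then show ?case using d by (auto simp: differentiable_def)
qed

text \<open>Serves to write a derivative applied to a moving vector as a finite sum of scalar
  functions times derivatives in fixed directions, the only kind of derivative that the recursion of
  \<open>Ck_on\<close> mentions.\<close>

lemma linear_euclidean_expand:
  fixes L :: "'a::euclidean_space \<Rightarrow> 'b::real_vector"
  assumes "linear L"
  shows "L v = (\<Sum>i\<in>Basis. (v \<bullet> i) *\<^sub>R L i)"
proof -
  have "L v = L (\<Sum>i\<in>Basis. (v \<bullet> i) *\<^sub>R i)" by (simp add: euclidean_representation)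
  then show ?thesis by (simp add: linear_sum[OF assms] linear_scale[OF assms])
qed

text \<open>In the chain rule the direction in which \<open>g\<close> is differentiated moves with
  \<open>x\<close>. Expanding it along \<open>Basis\<close> leaves derivatives of \<open>g\<close>
  in fixed directions, composed with \<open>f\<close>; the induction hypothesis covers these because
  \<open>f\<close> has one order of differentiability to spare.\<close>

lemma Ck_on_compose:
  fixes f :: "'a::real_normed_vector \<Rightarrow> 'b::euclidean_space"
  assumes "Ck_on n T g" "Ck_on n S f" "f ` S \<subseteq> T" "open S"
  shows "Ck_on n S (\<lambda>x. g (f x))"
  using assms(1-3)
proof (induction n arbitrary: f g)
  case 0
  then show ?case by (auto intro: continuous_on_compose2)
next
  case (Suc n)
  have d: "((\<lambda>x. g (f x)) has_derivative
      (\<lambda>v. frechet_derivative g (at (f x)) (frechet_derivative f (at x) v))) (at x)"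
    if "x \<in> S" for x
    by (rule has_derivative_compose[OF has_derivative_frechet has_derivative_frechet])
      (use Suc.prems that in auto)
  have "Ck_on n S (\<lambda>x. frechet_derivative (\<lambda>x. g (f x)) (at x) v)" for v
  proof (rule Ck_on_cong[OF _ assms(4)])
    show "Ck_on n S (\<lambda>x. \<Sum>i\<in>Basis.
        (frechet_derivative f (at x) v \<bullet> i) *\<^sub>R frechet_derivative g (at (f x)) i)"
    proof (intro Ck_on_sum Ck_on_bilinear[OF bounded_bilinear_scaleR] assms(4))
      fix i :: 'b
      show "Ck_on n S (\<lambda>x. frechet_derivative f (at x) v \<bullet> i)"
        by (rule Ck_on_bilinear[OF bounded_bilinear_inner])
          (use Suc.prems assms(4) in \<open>auto intro: Ck_on_const\<close>)
      show "Ck_on n S (\<lambda>x. frechet_derivative g (at (f x)) i)"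
        using Suc.prems Ck_on_SucD[OF Suc.prems(2)] by (intro Suc.IH) auto
    qed
  next
    fix x assume "x \<in> S"
    then have "linear (frechet_derivative g (at (f x)))"
      using Suc.prems by (intro linear_frechet_derivative) auto
    then show "(\<Sum>i\<in>Basis. (frechet_derivative f (at x) v \<bullet> i) *\<^sub>R frechet_derivative g (at (f x)) i)
        = frechet_derivative (\<lambda>x. g (f x)) (at x) v"
      by (simp add: frechet_derivative_eqI[OF d[OF \<open>x \<in> S\<close>]] linear_euclidean_expand[symmetric])
  qed
  then show ?case using d by (auto simp: differentiable_def)
qed

lemma Ck_on_Pair:
  assumes "Ck_on n S f" "Ck_on n S g" "open S"
  shows "Ck_on n S (\<lambda>x. (f x, g x))"
  using assms(1,2)
proof (induction n arbitrary: f g)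
  case 0
  then show ?case by (auto intro: continuous_intros)
next
  case (Suc n)
  have d: "((\<lambda>x. (f x, g x)) has_derivative
      (\<lambda>v. (frechet_derivative f (at x) v, frechet_derivative g (at x) v))) (at x)"
    if "x \<in> S" for x
    using Suc.prems that by (auto intro!: has_derivative_Pair has_derivative_frechet)
  have "Ck_on n S (\<lambda>x. frechet_derivative (\<lambda>x. (f x, g x)) (at x) v)" for v
    by (rule Ck_on_cong[OF _ assms(3)], rule Suc.IH)
      (use Suc.prems in \<open>simp_all add: frechet_derivative_eqI[OF d]\<close>)
  then show ?case using d by (auto simp: differentiable_def)
qed

lemma smooth_on_subset: "smooth_on S f \<Longrightarrow> T \<subseteq> S \<Longrightarrow> smooth_on T f"
  by (auto simp: smooth_on_def intro: Ck_on_subset)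

lemma smooth_on_cong: "smooth_on S f \<Longrightarrow> open S \<Longrightarrow> (\<And>x. x \<in> S \<Longrightarrow> f x = g x) \<Longrightarrow> smooth_on S g"
  unfolding smooth_on_def using Ck_on_cong by blast

lemma smooth_on_continuous: "smooth_on S f \<Longrightarrow> continuous_on S f"
  by (auto simp: smooth_on_def intro: Ck_on_continuous)

lemma smooth_on_differentiable: "smooth_on S f \<Longrightarrow> x \<in> S \<Longrightarrow> f differentiable (at x)"
  unfolding smooth_on_def by (metis Ck_on.simps(2))

lemma smooth_on_has_derivative:
  "smooth_on S f \<Longrightarrow> x \<in> S \<Longrightarrow> (f has_derivative frechet_derivative f (at x)) (at x)"
  by (simp add: has_derivative_frechet smooth_on_differentiable)

lemma smooth_on_linear: "bounded_linear f \<Longrightarrow> smooth_on S f"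
  by (simp add: smooth_on_def Ck_on_linear)

lemma smooth_on_const: "smooth_on S (\<lambda>x. c)"
  by (simp add: smooth_on_def Ck_on_const)

lemma smooth_on_ident: "smooth_on S (\<lambda>x. x)"
  by (simp add: smooth_on_linear bounded_linear_ident)

lemma smooth_on_compose:
  fixes f :: "'a::real_normed_vector \<Rightarrow> 'b::euclidean_space"
  shows "smooth_on T g \<Longrightarrow> smooth_on S f \<Longrightarrow> f ` S \<subseteq> T \<Longrightarrow> open S \<Longrightarrow> smooth_on S (\<lambda>x. g (f x))"
  by (auto simp: smooth_on_def intro: Ck_on_compose)

lemma smooth_on_Pair:
  "smooth_on S f \<Longrightarrow> smooth_on S g \<Longrightarrow> open S \<Longrightarrow> smooth_on S (\<lambda>x. (f x, g x))"
  by (auto simp: smooth_on_def intro: Ck_on_Pair)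

lemma smooth_on_local:
  "(\<And>p. p \<in> S \<Longrightarrow> \<exists>U. open U \<and> p \<in> U \<and> smooth_on U f) \<Longrightarrow> smooth_on S f"
  unfolding smooth_on_def by (metis Ck_on_local)

lemma smooth_on_frechet: "smooth_on S f \<Longrightarrow> smooth_on S (\<lambda>x. frechet_derivative f (at x) v)"
  unfolding smooth_on_def by (metis Ck_on.simps(2))

text \<open>The coordinate expression of a vector field applied to a function has this shape, with
  \<open>v\<close> the coefficient field; the expansion along \<open>Basis\<close> again reduces it
  to fixed directions.\<close>

lemma smooth_on_frechet_apply:
  fixes f :: "'a::euclidean_space \<Rightarrow> 'b::real_normed_vector"
  assumes "smooth_on S f" "smooth_on S v" "open S"
  shows "smooth_on S (\<lambda>x. frechet_derivative f (at x) (v x))"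
proof (rule smooth_on_cong[OF _ assms(3)])
  show "smooth_on S (\<lambda>x. \<Sum>i\<in>Basis. (v x \<bullet> i) *\<^sub>R frechet_derivative f (at x) i)"
    using assms smooth_on_frechet[OF assms(1)] unfolding smooth_on_def
    by (intro allI Ck_on_sum Ck_on_bilinear[OF bounded_bilinear_scaleR]
      Ck_on_bilinear[OF bounded_bilinear_inner] Ck_on_const) auto
  fix x assume "x \<in> S"
  then show "(\<Sum>i\<in>Basis. (v x \<bullet> i) *\<^sub>R frechet_derivative f (at x) i) = frechet_derivative f (at x) (v x)"
    using linear_euclidean_expand[OF linear_frechet_derivative[OF smooth_on_differentiable[OF assms(1)]]]
    by metis
qed

section \<open>Symmetry of second derivatives\<close>

lemma second_difference_mvt:
  fixes K :: "'a::real_normed_vector \<Rightarrow> real"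
  assumes K: "Ck_on 2 U K" and h: "0 < h"
    and U: "\<And>s t. 0 \<le> s \<Longrightarrow> s \<le> h \<Longrightarrow> 0 \<le> t \<Longrightarrow> t \<le> h \<Longrightarrow> p + s *\<^sub>R v + t *\<^sub>R w \<in> U"
  obtains s t where "0 \<le> s" "s \<le> h" "0 \<le> t" "t \<le> h"
    "K (p + h *\<^sub>R v + h *\<^sub>R w) - K (p + h *\<^sub>R v) - K (p + h *\<^sub>R w) + K p =
      h * h * frechet_derivative (\<lambda>q. frechet_derivative K (at q) v) (at (p + s *\<^sub>R v + t *\<^sub>R w)) w"
proof -
  have 2: "(2::nat) = Suc (Suc 0)" by simp
  have dK: "(K has_derivative frechet_derivative K (at q)) (at q)" if "q \<in> U" for q
    using K that by (simp add: 2 has_derivative_frechet)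
  define k where "k q = frechet_derivative K (at q) v" for q
  have dk: "(k has_derivative frechet_derivative k (at q)) (at q)" if "q \<in> U" for q
    using K that by (simp add: 2 has_derivative_frechet k_def[abs_def])
  have line: "((\<lambda>t. F (a + t *\<^sub>R u)) has_real_derivative F' u) (at t)"
    if "(F has_derivative F') (at (a + t *\<^sub>R u))" for F :: "'a \<Rightarrow> real" and F' a u t
  proof -
    have "((\<lambda>t. F (a + t *\<^sub>R u)) has_derivative (\<lambda>r. F' (r *\<^sub>R u))) (at t)"
      by (rule has_derivative_compose[where f = "\<lambda>t. a + t *\<^sub>R u" and g = F and g' = F', OF _ that])
        (auto intro!: derivative_eq_intros)
    moreover have "F' (r *\<^sub>R u) = r * F' u" for r
      using that by (metis has_derivative_linear linear_scale real_scaleR_def)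
    ultimately show ?thesis by (simp add: has_field_derivative_def mult_commute_abs)
  qed
  \<comment> \<open>First mean value, along \<open>v\<close>, for the difference \<open>K (p + h
    *\<^sub>R w + s *\<^sub>R v) - K (p + s *\<^sub>R v)\<close> as a function of \<open>s\<close>:
    its increment over \<open>[0, h]\<close> is the second difference.\<close>
  have "\<exists>s. 0 < s \<and> s < h \<and>
      (K (p + h *\<^sub>R w + h *\<^sub>R v) - K (p + h *\<^sub>R v)) - (K (p + h *\<^sub>R w + 0 *\<^sub>R v) - K (p + 0 *\<^sub>R v))
      = (h - 0) * (k (p + h *\<^sub>R w + s *\<^sub>R v) - k (p + s *\<^sub>R v))"
    unfolding k_def
    by (rule MVT2[OF h], intro DERIV_diff line dK)
      (use U[of _ h] U[of _ 0] h in \<open>auto simp: algebra_simps\<close>)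
  then obtain s where s: "0 < s" "s < h" and
    eq: "(K (p + h *\<^sub>R w + h *\<^sub>R v) - K (p + h *\<^sub>R v)) - (K (p + h *\<^sub>R w) - K p)
      = h * (k (p + h *\<^sub>R w + s *\<^sub>R v) - k (p + s *\<^sub>R v))" by auto
  \<comment> \<open>Second mean value, along \<open>w\<close>, for the directional derivative
    \<open>k\<close> with \<open>s\<close> now fixed.\<close>
  have "\<exists>t. 0 < t \<and> t < h \<and>
      k (p + s *\<^sub>R v + h *\<^sub>R w) - k (p + s *\<^sub>R v + 0 *\<^sub>R w)
      = (h - 0) * frechet_derivative k (at (p + s *\<^sub>R v + t *\<^sub>R w)) w"
    by (rule MVT2[OF h], intro line dk U) (use s in auto)
  then obtain t where t: "0 < t" "t < h" and
    eq': "k (p + s *\<^sub>R v + h *\<^sub>R w) - k (p + s *\<^sub>R v)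
      = h * frechet_derivative k (at (p + s *\<^sub>R v + t *\<^sub>R w)) w" by auto
  have c: "p + h *\<^sub>R w + x *\<^sub>R v = p + x *\<^sub>R v + h *\<^sub>R w" for x by simp
  show ?thesis
    by (rule that[of s t]) (use s t eq eq' in \<open>simp_all add: c k_def[abs_def]\<close>)
qed

text \<open>The second difference is symmetric in \<open>v\<close> and \<open>w\<close>, so the mean
  value theorem produces both mixed derivatives with equal values at two points near
  \<open>p\<close>; by continuity they cannot differ at \<open>p\<close>.\<close>

lemma frechet_derivative_symmetric:
  fixes K :: "'a::real_normed_vector \<Rightarrow> real"
  assumes K: "Ck_on 2 U K" and U: "open U" "p \<in> U"
  shows "frechet_derivative (\<lambda>q. frechet_derivative K (at q) v) (at p) w
       = frechet_derivative (\<lambda>q. frechet_derivative K (at q) w) (at p) v"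
proof (rule ccontr)
  define A where "A q = frechet_derivative (\<lambda>q. frechet_derivative K (at q) v) (at q) w" for q
  define B where "B q = frechet_derivative (\<lambda>q. frechet_derivative K (at q) w) (at q) v" for q
  have 2: "(2::nat) = Suc (Suc 0)" by simp
  have "continuous_on U A" "continuous_on U B"
    using K by (auto simp: 2 A_def[abs_def] B_def[abs_def])
  then have "isCont A p" "isCont B p" using U by (auto simp: continuous_on_eq_continuous_at)
  assume "\<not> ?thesis"
  then have "A p \<noteq> B p" by (simp add: A_def B_def)
  \<comment> \<open>Half the distance, so that two errors below \<open>e\<close> cannot bridge
    it.\<close>
  define e where "e = dist (A p) (B p) / 2"
  have "e > 0" using \<open>A p \<noteq> B p\<close> by (simp add: e_def)
  obtain d1 where d1: "d1 > 0" "\<And>q. dist q p < d1 \<Longrightarrow> dist (A q) (A p) < e"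
    using \<open>isCont A p\<close> \<open>e > 0\<close> unfolding continuous_at_eps_delta by blast
  obtain d2 where d2: "d2 > 0" "\<And>q. dist q p < d2 \<Longrightarrow> dist (B q) (B p) < e"
    using \<open>isCont B p\<close> \<open>e > 0\<close> unfolding continuous_at_eps_delta by blast
  obtain d3 where d3: "d3 > 0" "ball p d3 \<subseteq> U" using U openE by blast
  define d where "d = min d1 (min d2 d3)"
  have "d > 0" using d1 d2 d3 by (simp add: d_def)
  \<comment> \<open>The summand 1 keeps the denominator positive when \<open>v\<close> and
    \<open>w\<close> vanish and makes \<open>h * norm v + h * norm w\<close> strictly smaller than
    \<open>d\<close>.\<close>
  define h where "h = d / (norm v + norm w + 1)"
  have "h > 0" using \<open>d > 0\<close> by (simp add: h_def add_nonneg_pos)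
  have hd: "h * (norm v + norm w + 1) = d"
    unfolding h_def by (simp add: add_nonneg_pos[THEN less_imp_neq, THEN not_sym])
  have close: "dist (p + s *\<^sub>R v + t *\<^sub>R w) p < d"
    if "0 \<le> s" "s \<le> h" "0 \<le> t" "t \<le> h" for s t
  proof -
    have "dist (p + s *\<^sub>R v + t *\<^sub>R w) p \<le> norm (s *\<^sub>R v) + norm (t *\<^sub>R w)"
      using norm_triangle_ineq[of "s *\<^sub>R v" "t *\<^sub>R w"] by (simp add: dist_norm algebra_simps)
    also have "\<dots> \<le> h * norm v + h * norm w"
      using that by (auto intro!: add_mono mult_right_mono)
    also have "\<dots> < d" using hd \<open>h > 0\<close> by (simp add: algebra_simps)
    finally show ?thesis .
  qed
  have inU: "p + s *\<^sub>R v + t *\<^sub>R w \<in> U" if "0 \<le> s" "s \<le> h" "0 \<le> t" "t \<le> h" for s t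
    using close[OF that] d3 by (auto simp: d_def dist_commute)
  have inU': "p + t *\<^sub>R w + s *\<^sub>R v \<in> U" if "0 \<le> t" "t \<le> h" "0 \<le> s" "s \<le> h" for s t
    using inU[OF that(3,4,1,2)] by (simp add: algebra_simps)
  obtain s t where st: "0 \<le> s" "s \<le> h" "0 \<le> t" "t \<le> h"
    "K (p + h *\<^sub>R v + h *\<^sub>R w) - K (p + h *\<^sub>R v) - K (p + h *\<^sub>R w) + K p = h * h * A (p + s *\<^sub>R v + t *\<^sub>R w)"
    using second_difference_mvt[OF K \<open>h > 0\<close> inU] unfolding A_def by blast
  obtain t' s' where st': "0 \<le> t'" "t' \<le> h" "0 \<le> s'" "s' \<le> h"
    "K (p + h *\<^sub>R w + h *\<^sub>R v) - K (p + h *\<^sub>R w) - K (p + h *\<^sub>R v) + K p = h * h * B (p + t' *\<^sub>R w + s' *\<^sub>R v)"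
    using second_difference_mvt[OF K \<open>h > 0\<close> inU'] unfolding B_def by blast
  have comm: "p + h *\<^sub>R w + h *\<^sub>R v = p + h *\<^sub>R v + h *\<^sub>R w" "p + t' *\<^sub>R w + s' *\<^sub>R v = p + s' *\<^sub>R v + t' *\<^sub>R w"
    by simp_all
  have "h * h * A (p + s *\<^sub>R v + t *\<^sub>R w) = h * h * B (p + s' *\<^sub>R v + t' *\<^sub>R w)"
    using st(5) st'(5)[unfolded comm] by linarith
  with \<open>h > 0\<close> have "A (p + s *\<^sub>R v + t *\<^sub>R w) = B (p + s' *\<^sub>R v + t' *\<^sub>R w)"
    by simp
  moreover have "dist (A (p + s *\<^sub>R v + t *\<^sub>R w)) (A p) < e"
    using close[OF st(1-4)] d1 by (simp add: d_def)
  moreover have "dist (B (p + s' *\<^sub>R v + t' *\<^sub>R w)) (B p) < e"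
    using close[OF st'(3,4,1,2)] d2 by (simp add: d_def)
  ultimately have "dist (A p) (B p) < 2 * e" by (metis dist_commute dist_triangle_half_r
    field_sum_of_halves mult_2 nonzero_mult_div_cancel_left zero_neq_numeral)
  then show False by (simp add: e_def)
qed

section \<open>Local smoothness of maps between manifolds\<close>

text \<open>The chart homeomorphism is unfolded into injectivity, open images and open preimages; in
  this form the conditions are checked directly for \<open>euc\<close> and for products.\<close>

definition charted :: "('a, 'e::euclidean_space) mfd \<Rightarrow> bool" where
  "charted M \<longleftrightarrow>
     (\<Union>c\<in>atlas M. fst c) = topspace (mtop M) \<and>
     (\<forall>c\<in>atlas M. openin (mtop M) (fst c) \<and> inj_on (snd c) (fst c) \<and>
        (\<forall>V. openin (mtop M) V \<longrightarrow> open (snd c ` (fst c \<inter> V))) \<and>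
        (\<forall>U. open U \<longrightarrow> openin (mtop M) {x \<in> fst c. snd c x \<in> U})) \<and>
     (\<forall>c\<in>atlas M. \<forall>d\<in>atlas M.
        smooth_on (snd c ` (fst c \<inter> fst d)) (snd d \<circ> chart_inv c))"

text \<open>With Euclidean space as a one-chart manifold, real functions, charts and inverse charts
  all become maps between manifolds and share one composition rule.\<close>

definition euc :: "('e::euclidean_space, 'e) mfd" where
  "euc = \<lparr>mtop = euclidean, atlas = {(UNIV, \<lambda>x. x)}\<rparr>"

definition smooth_in ::
  "('a, 'e::euclidean_space) mfd \<Rightarrow> ('a, 'e) chart \<Rightarrow> ('b, 'f::euclidean_space) chart \<Rightarrow>
   ('a \<Rightarrow> 'b) \<Rightarrow> 'a set \<Rightarrow> bool" where
  "smooth_in M c d F V \<longleftrightarrow> openin (mtop M) V \<and> V \<subseteq> fst c \<and> F ` V \<subseteq> fst d \<and>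
     smooth_on (snd c ` V) (\<lambda>u. snd d (F (chart_inv c u)))"

text \<open>Smoothness of a germ, continuity included: \<open>V\<close> is an open set that
  \<open>F\<close> maps into a single chart domain. One pair of charts is enough, since
  \<open>smooth_at_in_charts\<close> passes to any other pair around the same points.\<close>

definition smooth_at ::
  "('a, 'e::euclidean_space) mfd \<Rightarrow> ('b, 'f::euclidean_space) mfd \<Rightarrow> ('a \<Rightarrow> 'b) \<Rightarrow> 'a \<Rightarrow> bool" where
  "smooth_at M N F x \<longleftrightarrow> (\<exists>c\<in>atlas M. \<exists>d\<in>atlas N. \<exists>V. x \<in> V \<and> smooth_in M c d F V)"

lemma mtop_euc [simp]: "mtop euc = euclidean"
  by (simp add: euc_def)

lemma atlas_euc [simp]: "atlas euc = {(UNIV, \<lambda>x. x)}"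
  by (simp add: euc_def)

lemma inv_into_UNIV_ident [simp]: "inv_into UNIV (\<lambda>x. x) = (\<lambda>x. x)"
  by (auto simp: inv_into_def)

lemma charted_euc [simp]: "charted euc"
  by (auto simp: charted_def comp_def intro: smooth_on_ident)

lemma smooth_manifold_charted:
  assumes "smooth_manifold M"
  shows "charted M"
  unfolding charted_def
proof (intro conjI ballI allI impI)
  fix c assume c: "c \<in> atlas M"
  let ?T = "subtopology (mtop M) (fst c)" and ?E = "top_of_set (snd c ` fst c)"
  have o: "openin (mtop M) (fst c)" "open (snd c ` fst c)"
    and hom: "homeomorphic_map ?T ?E (snd c)"
    using assms c by (auto simp: smooth_manifold_def)
  have ts: "topspace ?T = fst c" using o(1) openin_subset by fastforce
  show "openin (mtop M) (fst c)" by fact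
  show "inj_on (snd c) (fst c)" using hom ts by (metis homeomorphic_imp_injective_map)
  show "open (snd c ` (fst c \<inter> V))" if "openin (mtop M) V" for V
  proof -
    have "openin ?T (fst c \<inter> V)" using that by (simp add: openin_subtopology_Int2)
    then have "openin ?E (snd c ` (fst c \<inter> V))"
      using homeomorphic_imp_open_map[OF hom] by (simp add: open_map_def)
    then show ?thesis using o(2) openin_open_trans by blast
  qed
  show "openin (mtop M) {x \<in> fst c. snd c x \<in> U}" if "open U" for U
  proof -
    have "openin ?E (snd c ` fst c \<inter> U)" using that by (simp add: openin_open_Int)
    then have "openin ?T {x \<in> topspace ?T. snd c x \<in> snd c ` fst c \<inter> U}"
      using homeomorphic_imp_continuous_map[OF hom] openin_continuous_map_preimage by blast
    moreover have "{x \<in> topspace ?T. snd c x \<in> snd c ` fst c \<inter> U} = {x \<in> fst c. snd c x \<in> U}"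
      unfolding ts by auto
    ultimately show ?thesis using o(1) openin_trans_full by fastforce
  qed
qed (use assms in \<open>auto simp: smooth_manifold_def\<close>)

lemma chartedD:
  assumes "charted M" "c \<in> atlas M"
  shows "openin (mtop M) (fst c)" "inj_on (snd c) (fst c)"
    "\<And>V. openin (mtop M) V \<Longrightarrow> open (snd c ` (fst c \<inter> V))"
    "\<And>U. open U \<Longrightarrow> openin (mtop M) {x \<in> fst c. snd c x \<in> U}"
    "\<And>x. x \<in> fst c \<Longrightarrow> x \<in> topspace (mtop M)"
  using assms by (auto simp: charted_def)

lemma charted_open_image:
  "charted M \<Longrightarrow> c \<in> atlas M \<Longrightarrow> openin (mtop M) V \<Longrightarrow> V \<subseteq> fst c \<Longrightarrow> open (snd c ` V)"
  using chartedD(3) by (metis inf.absorb2)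

lemma charted_open_range: "charted M \<Longrightarrow> c \<in> atlas M \<Longrightarrow> open (snd c ` fst c)"
  by (simp add: charted_open_image chartedD(1))

lemma charted_inv: "charted M \<Longrightarrow> c \<in> atlas M \<Longrightarrow> x \<in> fst c \<Longrightarrow> chart_inv c (snd c x) = x"
  using chartedD(2) by (metis inv_into_f_f)

lemma charted_obtain:
  assumes "charted M" "x \<in> topspace (mtop M)"
  obtains c where "c \<in> atlas M" "x \<in> fst c"
  using assms unfolding charted_def by (metis UN_E)

lemma chart_inv_prod:
  assumes "inj_on f A" "inj_on g B" "p \<in> A \<times> B"
  shows "inv_into (A \<times> B) (map_prod f g) (map_prod f g p) = p"
  using assms by (intro inv_into_f_f map_prod_inj_on)

lemma prod_chart_in_atlas:
  "c \<in> atlas M \<Longrightarrow> d \<in> atlas N \<Longrightarrow>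
    (fst c \<times> fst d, map_prod (snd c) (snd d)) \<in> atlas (prod_mfd M N)"
  unfolding prod_mfd_def mfd.simps by blast

lemma charted_prod [simp]:
  assumes M: "charted M" and N: "charted N"
  shows "charted (prod_mfd M N)"
proof -
  let ?P = "prod_topology (mtop M) (mtop N)"
  have op: "openin ?P (fst c \<times> fst d)" if "c \<in> atlas M" "d \<in> atlas N" for c d
    using that M N by (simp add: openin_prod_Times_iff chartedD)
  have im: "open (map_prod (snd c) (snd d) ` (fst c \<times> fst d \<inter> V))"
    if cd: "c \<in> atlas M" "d \<in> atlas N" "openin ?P V" for c d V
  proof (rule open_prod_intro)
    fix p assume "p \<in> map_prod (snd c) (snd d) ` (fst c \<times> fst d \<inter> V)"
    then obtain x y where xy: "p = (snd c x, snd d y)" "x \<in> fst c" "y \<in> fst d" "(x, y) \<in> V" by auto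
    then obtain A B where AB: "openin (mtop M) A" "openin (mtop N) B" "x \<in> A" "y \<in> B" "A \<times> B \<subseteq> V"
      using cd(3) unfolding openin_prod_topology_alt by meson
    show "\<exists>A B. open A \<and> open B \<and> p \<in> A \<times> B \<and>
        A \<times> B \<subseteq> map_prod (snd c) (snd d) ` (fst c \<times> fst d \<inter> V)"
      by (intro exI[of _ "snd c ` (fst c \<inter> A)"] exI[of _ "snd d ` (fst d \<inter> B)"])
        (use xy AB chartedD(3)[OF M cd(1)] chartedD(3)[OF N cd(2)] in \<open>auto simp: map_prod_def\<close>)
  qed
  have pre: "openin ?P {p \<in> fst c \<times> fst d. map_prod (snd c) (snd d) p \<in> U}"
    if cd: "c \<in> atlas M" "d \<in> atlas N" "open U" for c d U
    unfolding openin_prod_topology_alt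
  proof (intro allI impI)
    fix x y assume "(x, y) \<in> {p \<in> fst c \<times> fst d. map_prod (snd c) (snd d) p \<in> U}"
    then have xy: "x \<in> fst c" "y \<in> fst d" "(snd c x, snd d y) \<in> U" by auto
    obtain A B where "open A" "open B" "(snd c x, snd d y) \<in> A \<times> B" "A \<times> B \<subseteq> U"
      by (rule open_prod_elim[OF cd(3) xy(3)])
    then show "\<exists>A B. openin (mtop M) A \<and> openin (mtop N) B \<and> x \<in> A \<and> y \<in> B \<and>
        A \<times> B \<subseteq> {p \<in> fst c \<times> fst d. map_prod (snd c) (snd d) p \<in> U}"
      by (intro exI[of _ "{z \<in> fst c. snd c z \<in> A}"] exI[of _ "{z \<in> fst d. snd d z \<in> B}"])
        (use xy chartedD(4)[OF M cd(1)] chartedD(4)[OF N cd(2)] in auto)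
  qed
  \<comment> \<open>A transition map of product charts acts on each factor separately, so it is a
    pair of transition maps composed with the two projections.\<close>
  have tr: "smooth_on (map_prod (snd c) (snd d) ` (fst c \<times> fst d \<inter> fst c' \<times> fst d'))
       (map_prod (snd c') (snd d') \<circ> inv_into (fst c \<times> fst d) (map_prod (snd c) (snd d)))"
    if "c \<in> atlas M" "d \<in> atlas N" "c' \<in> atlas M" "d' \<in> atlas N" for c d c' d'
  proof (rule smooth_on_cong)
    let ?S = "map_prod (snd c) (snd d) ` (fst c \<times> fst d \<inter> fst c' \<times> fst d')"
    show S: "open ?S" using that by (intro im op)
    have 1: "fst ` ?S \<subseteq> snd c ` (fst c \<inter> fst c')" "snd ` ?S \<subseteq> snd d ` (fst d \<inter> fst d')" by auto
    have s1: "smooth_on (snd c ` (fst c \<inter> fst c')) (\<lambda>x. snd c' (chart_inv c x))"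
      and s2: "smooth_on (snd d ` (fst d \<inter> fst d')) (\<lambda>x. snd d' (chart_inv d x))"
      using M N that by (auto simp: charted_def comp_def)
    show "smooth_on ?S (\<lambda>p. (snd c' (chart_inv c (fst p)), snd d' (chart_inv d (snd p))))"
      by (intro smooth_on_Pair S smooth_on_compose[OF s1 _ 1(1)] smooth_on_compose[OF s2 _ 1(2)]
        smooth_on_linear bounded_linear_fst bounded_linear_snd)
    fix p assume "p \<in> ?S"
    then obtain x y where "p = (snd c x, snd d y)" and xy: "x \<in> fst c" "y \<in> fst d" by auto
    then have p: "p = map_prod (snd c) (snd d) (x, y)" by simp
    show "(snd c' (chart_inv c (fst p)), snd d' (chart_inv d (snd p))) =
      (map_prod (snd c') (snd d') \<circ> inv_into (fst c \<times> fst d) (map_prod (snd c) (snd d))) p"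
      unfolding p comp_def
        chart_inv_prod[OF chartedD(2)[OF M that(1)] chartedD(2)[OF N that(2)] SigmaI[OF xy]]
      by (simp add: charted_inv[OF M that(1) xy(1)] charted_inv[OF N that(2) xy(2)])
  qed
  have un: "(\<Union>c\<in>atlas (prod_mfd M N). fst c) = topspace (mtop M) \<times> topspace (mtop N)"
  proof (intro subset_antisym subsetI)
    fix p assume "p \<in> topspace (mtop M) \<times> topspace (mtop N)"
    then have "fst p \<in> topspace (mtop M)" "snd p \<in> topspace (mtop N)" by auto
    then obtain c d where "c \<in> atlas M" "fst p \<in> fst c" "d \<in> atlas N" "snd p \<in> fst d"
      using charted_obtain[OF M] charted_obtain[OF N] by metis
    then show "p \<in> (\<Union>c\<in>atlas (prod_mfd M N). fst c)"
      by (intro UN_I[OF prod_chart_in_atlas]) (auto simp: mem_Times_iff)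
  next
    fix p assume "p \<in> (\<Union>c\<in>atlas (prod_mfd M N). fst c)"
    then obtain c d where "c \<in> atlas M" "d \<in> atlas N" "p \<in> fst c \<times> fst d"
      by (auto simp: prod_mfd_def)
    then show "p \<in> topspace (mtop M) \<times> topspace (mtop N)"
      using chartedD(5)[OF M] chartedD(5)[OF N] by (auto simp: mem_Times_iff)
  qed
  have inj: "inj_on (map_prod (snd c) (snd d)) (fst c \<times> fst d)"
    if "c \<in> atlas M" "d \<in> atlas N" for c d
    using that by (simp add: map_prod_inj_on chartedD[OF M] chartedD[OF N])
  have top: "mtop (prod_mfd M N) = ?P"
    and at: "\<And>e. e \<in> atlas (prod_mfd M N) \<Longrightarrow>
      \<exists>c\<in>atlas M. \<exists>d\<in>atlas N. e = (fst c \<times> fst d, map_prod (snd c) (snd d))"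
    unfolding prod_mfd_def mfd.simps by (rule refl, blast)
  show ?thesis
    unfolding charted_def top topspace_prod_topology
  proof (intro conjI)
    show "\<forall>c\<in>atlas (prod_mfd M N). openin ?P (fst c) \<and> inj_on (snd c) (fst c) \<and>
        (\<forall>V. openin ?P V \<longrightarrow> open (snd c ` (fst c \<inter> V))) \<and>
        (\<forall>U. open U \<longrightarrow> openin ?P {x \<in> fst c. snd c x \<in> U})"
      by (rule ballI, drule at, elim bexE) (simp add: op im pre inj)
    show "\<forall>c\<in>atlas (prod_mfd M N). \<forall>d\<in>atlas (prod_mfd M N).
        smooth_on (snd c ` (fst c \<inter> fst d)) (snd d \<circ> chart_inv c)"
      by (intro ballI, (drule at)+, elim bexE) (simp add: tr)
  qed (rule un)
qed

lemma topspace_prod_mfd [simp]: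
  "topspace (mtop (prod_mfd M N)) = topspace (mtop M) \<times> topspace (mtop N)"
  by (simp add: prod_mfd_def)

lemma prod_euc: "prod_mfd euc euc = euc"
proof -
  have "map_prod (\<lambda>x. x) (\<lambda>x. x) = (\<lambda>x. x)" by auto
  then show ?thesis by (simp add: prod_mfd_def euc_def)
qed

text \<open>Continuity is recovered from coordinates: the expression of \<open>F\<close> in charts
  is continuous on an open set, and the chart \<open>c\<close> pulls the resulting open set back to
  \<open>M\<close>.\<close>

lemma smooth_in_preimage:
  assumes "charted M" "charted N" "c \<in> atlas M" "d \<in> atlas N" "smooth_in M c d F V" "openin (mtop N) T"
  shows "openin (mtop M) {z \<in> V. F z \<in> T}"
proof -
  let ?g = "\<lambda>u. snd d (F (chart_inv c u))"
  have V: "openin (mtop M) V" "V \<subseteq> fst c" "F ` V \<subseteq> fst d" "smooth_on (snd c ` V) ?g"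
    using assms by (auto simp: smooth_in_def)
  have "open (snd c ` V)" using V assms by (intro charted_open_image)
  then have "open (snd c ` V \<inter> ?g -` (snd d ` (fst d \<inter> T)))"
    using assms V by (metis chartedD(3) continuous_open_preimage smooth_on_continuous)
  then have o: "openin (mtop M) {z \<in> fst c. snd c z \<in> snd c ` V \<inter> ?g -` (snd d ` (fst d \<inter> T))}"
    using assms chartedD(4) by blast
  \<comment> \<open>Equal coordinates give equal points only inside the domain of \<open>d\<close>,
    where the chart is injective; \<open>F\<close> maps \<open>V\<close> into it.\<close>
  have "F z \<in> T \<longleftrightarrow> snd d (F z) \<in> snd d ` (fst d \<inter> T)" if "z \<in> V" for z
  proof
    assume "snd d (F z) \<in> snd d ` (fst d \<inter> T)"
    then obtain y where y: "y \<in> fst d" "y \<in> T" "snd d (F z) = snd d y" by auto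
    moreover have "F z \<in> fst d" using V that by auto
    ultimately show "F z \<in> T" using inj_onD[OF chartedD(2)[OF assms(2,4)] y(3)] by simp
  qed (use V that in auto)
  moreover have "chart_inv c (snd c z) = z" if "z \<in> V" for z
    by (rule charted_inv[OF assms(1,3)]) (use V that in auto)
  ultimately have "z \<in> V \<and> F z \<in> T \<longleftrightarrow>
      z \<in> V \<and> z \<in> fst c \<and> snd c z \<in> snd c ` V \<inter> ?g -` (snd d ` (fst d \<inter> T))" for z
    using V(2) by (cases "z \<in> V") auto
  then have "{z \<in> V. F z \<in> T} = V \<inter> {z \<in> fst c. snd c z \<in> snd c ` V \<inter> ?g -` (snd d ` (fst d \<inter> T))}"
    by blast
  then show ?thesis using o V(1) by auto
qed

lemma smooth_in_subset:
  "smooth_in M c d F V \<Longrightarrow> openin (mtop M) V' \<Longrightarrow> V' \<subseteq> V \<Longrightarrow> smooth_in M c d F V'"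
  unfolding smooth_in_def by (auto intro: smooth_on_subset)

lemma smooth_in_compose:
  assumes "charted M" "charted N" "c \<in> atlas M" "d \<in> atlas N"
    and F: "smooth_in M c d F V" and H: "smooth_in N d e H T"
  shows "smooth_in M c e (\<lambda>x. H (F x)) {z \<in> V. F z \<in> T}"
proof -
  let ?V = "{z \<in> V. F z \<in> T}"
  have V: "openin (mtop M) ?V"
    using assms by (intro smooth_in_preimage[of M N c d]) (auto simp: smooth_in_def)
  have inc: "?V \<subseteq> fst c" using F by (auto simp: smooth_in_def)
  have op: "open (snd c ` ?V)" using V inc assms by (intro charted_open_image)
  have i1: "chart_inv c (snd c z) = z" if "z \<in> V" for z
    by (rule charted_inv[OF assms(1,3)]) (use that F in \<open>auto simp: smooth_in_def\<close>)
  have i2: "chart_inv d (snd d (F z)) = F z" if "z \<in> V" for z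
    by (rule charted_inv[OF assms(2,4)]) (use that F in \<open>auto simp: smooth_in_def\<close>)
  have "smooth_on (snd c ` ?V) (\<lambda>u. snd e (H (chart_inv d (snd d (F (chart_inv c u))))))"
    by (rule smooth_on_compose[where f = "\<lambda>u. snd d (F (chart_inv c u))" and T = "snd d ` T"])
      (use F H op i1 in \<open>auto simp: smooth_in_def intro: smooth_on_subset\<close>)
  then have "smooth_on (snd c ` ?V) (\<lambda>u. snd e (H (F (chart_inv c u))))"
    by (rule smooth_on_cong) (use op i1 i2 in auto)
  then show ?thesis using V inc H by (auto simp: smooth_in_def)
qed

lemma smooth_in_ident:
  assumes "charted M" "c \<in> atlas M" "c' \<in> atlas M"
  shows "smooth_in M c c' (\<lambda>x. x) (fst c \<inter> fst c')"
  using assms by (auto simp: smooth_in_def charted_def comp_def)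

lemma smooth_atI:
  "c \<in> atlas M \<Longrightarrow> d \<in> atlas N \<Longrightarrow> x \<in> V \<Longrightarrow> smooth_in M c d F V \<Longrightarrow> smooth_at M N F x"
  unfolding smooth_at_def by blast

lemma smooth_at_topspace:
  assumes "charted M" "charted N" "smooth_at M N F x"
  shows "x \<in> topspace (mtop M)" "F x \<in> topspace (mtop N)"
  using assms chartedD(5)[of M] chartedD(5)[of N] unfolding smooth_at_def smooth_in_def by blast+

text \<open>A change of charts is composition with the identity read in two charts, once on the
  target side and once on the source side.\<close>

lemma smooth_at_in_charts:
  assumes "charted M" "charted N" "smooth_at M N F x" "c \<in> atlas M" "d \<in> atlas N" "x \<in> fst c" "F x \<in> fst d"
  obtains V where "x \<in> V" "smooth_in M c d F V"
proof -
  obtain c' d' V' where V': "c' \<in> atlas M" "d' \<in> atlas N" "x \<in> V'" "smooth_in M c' d' F V'"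
    using assms by (auto simp: smooth_at_def)
  have x: "x \<in> fst c'" "F x \<in> fst d'" using V' by (auto simp: smooth_in_def)
  have "smooth_in M c' d F {z \<in> V'. F z \<in> fst d' \<inter> fst d}"
    using assms V' by (intro smooth_in_compose[OF assms(1,2) _ _ V'(4) smooth_in_ident])
  from smooth_in_compose[OF assms(1,1,4) V'(1) smooth_in_ident[OF assms(1,4) V'(1)] this]
  show thesis by (rule that[rotated]) (use x V' assms in auto)
qed

lemma smooth_at_compose:
  assumes "charted M" "charted N" "charted L" "smooth_at M N F x" "smooth_at N L H (F x)"
  shows "smooth_at M L (\<lambda>x. H (F x)) x"
proof -
  have x: "x \<in> topspace (mtop M)" by (rule smooth_at_topspace(1)[OF assms(1,2,4)])
  obtain d e T where T: "d \<in> atlas N" "e \<in> atlas L" "F x \<in> T" "smooth_in N d e H T"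
    using assms by (auto simp: smooth_at_def)
  obtain c where c: "c \<in> atlas M" "x \<in> fst c" using charted_obtain[OF assms(1) x] .
  have "F x \<in> fst d" using T by (auto simp: smooth_in_def)
  then obtain V where V: "x \<in> V" "smooth_in M c d F V"
    using smooth_at_in_charts[OF assms(1,2,4) c(1) T(1) c(2)] by blast
  show ?thesis
    by (rule smooth_atI[OF c(1) T(2) _ smooth_in_compose[OF assms(1,2) c(1) T(1) V(2) T(4)]])
      (use V T in auto)
qed

lemma smooth_at_compose':
  assumes "charted M" "charted N" "charted L" "smooth_at M N F x" "smooth_at N L H y" "F x = y"
  shows "smooth_at M L (\<lambda>x. H (F x)) x"
  using smooth_at_compose[OF assms(1-4)] assms(5,6) by blast

lemma smooth_at_open:
  assumes "charted M" "charted N" "smooth_at M N F x" "openin (mtop N) T" "F x \<in> T"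
  obtains V where "openin (mtop M) V" "x \<in> V" "\<And>z. z \<in> V \<Longrightarrow> F z \<in> T"
proof -
  obtain c d V where V: "c \<in> atlas M" "d \<in> atlas N" "x \<in> V" "smooth_in M c d F V"
    using assms(3) by (auto simp: smooth_at_def)
  show thesis
    by (rule that[OF smooth_in_preimage[OF assms(1,2) V(1,2,4) assms(4)]]) (use V assms in auto)
qed

lemma smooth_at_eventually:
  assumes "smooth_at M N F x"
  obtains V where "openin (mtop M) V" "x \<in> V" "\<And>z. z \<in> V \<Longrightarrow> smooth_at M N F z"
  using assms unfolding smooth_at_def smooth_in_def by blast

lemma smooth_at_cong:
  assumes "charted M" "smooth_at M N F x" "openin (mtop M) V" "x \<in> V" "\<And>z. z \<in> V \<Longrightarrow> F z = H z"
  shows "smooth_at M N H x"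
proof -
  obtain c d V' where V': "c \<in> atlas M" "d \<in> atlas N" "x \<in> V'" "smooth_in M c d F V'"
    using assms by (auto simp: smooth_at_def)
  have 1: "smooth_in M c d F (V' \<inter> V)"
    by (rule smooth_in_subset[OF V'(4)]) (use V' assms in \<open>auto simp: smooth_in_def\<close>)
  have "open (snd c ` (V' \<inter> V))"
    using 1 assms V' by (auto intro!: charted_open_image simp: smooth_in_def)
  then have "smooth_on (snd c ` (V' \<inter> V)) (\<lambda>u. snd d (H (chart_inv c u)))"
  proof (rule smooth_on_cong[rotated])
    show "smooth_on (snd c ` (V' \<inter> V)) (\<lambda>u. snd d (F (chart_inv c u)))"
      using 1 by (simp add: smooth_in_def)
    fix u assume "u \<in> snd c ` (V' \<inter> V)"
    then obtain z where "u = snd c z" "z \<in> V" "z \<in> fst c" using 1 by (auto simp: smooth_in_def)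
    then show "snd d (F (chart_inv c u)) = snd d (H (chart_inv c u))"
      using assms(5) charted_inv[OF assms(1) V'(1)] by simp
  qed
  then have "smooth_in M c d H (V' \<inter> V)"
    using 1 assms unfolding smooth_in_def by (auto simp: image_subset_iff)
  then show ?thesis using V' assms unfolding smooth_at_def by blast
qed

lemma smooth_at_ident: "charted M \<Longrightarrow> x \<in> topspace (mtop M) \<Longrightarrow> smooth_at M M (\<lambda>x. x) x"
  using smooth_in_ident unfolding smooth_at_def by (metis Int_absorb charted_obtain)

lemma smooth_at_const:
  assumes "charted M" "charted N" "x \<in> topspace (mtop M)" "y \<in> topspace (mtop N)"
  shows "smooth_at M N (\<lambda>x. y) x"
proof -
  obtain c d where "c \<in> atlas M" "x \<in> fst c" "d \<in> atlas N" "y \<in> fst d"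
    using assms charted_obtain by metis
  then show ?thesis unfolding smooth_at_def smooth_in_def
    using chartedD(1)[OF assms(1)] smooth_on_const by blast
qed

lemma smooth_at_Pair:
  assumes "charted L" "charted M" "charted N" "smooth_at L M F x" "smooth_at L N H x"
  shows "smooth_at L (prod_mfd M N) (\<lambda>x. (F x, H x)) x"
proof -
  have x: "x \<in> topspace (mtop L)" "F x \<in> topspace (mtop M)" "H x \<in> topspace (mtop N)"
    
    using smooth_at_topspace[OF assms(1,2,4)] smooth_at_topspace[OF assms(1,3,5)] by auto
  obtain c where c: "c \<in> atlas L" "x \<in> fst c" using charted_obtain[OF assms(1) x(1)] .
  obtain d where d: "d \<in> atlas M" "F x \<in> fst d" using charted_obtain[OF assms(2) x(2)] .
  obtain e where e: "e \<in> atlas N" "H x \<in> fst e" using charted_obtain[OF assms(3) x(3)] .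
  obtain V where V: "x \<in> V" "smooth_in L c d F V"
    using smooth_at_in_charts[OF assms(1,2,4) c(1) d(1) c(2) d(2)] .
  obtain V' where V': "x \<in> V'" "smooth_in L c e H V'"
    using smooth_at_in_charts[OF assms(1,3,5) c(1) e(1) c(2) e(2)] .
  let ?de = "(fst d \<times> fst e, map_prod (snd d) (snd e))"
  have o: "openin (mtop L) (V \<inter> V')" "V \<inter> V' \<subseteq> fst c" using V V' by (auto simp: smooth_in_def)
  have "open (snd c ` (V \<inter> V'))" using o charted_open_image[OF assms(1) c(1)] by blast
  then have "smooth_in L c ?de (\<lambda>x. (F x, H x)) (V \<inter> V')"
    using V V' o unfolding smooth_in_def
    by (auto intro!: smooth_on_Pair intro: smooth_on_subset)
  moreover have "?de \<in> atlas (prod_mfd M N)" by (rule prod_chart_in_atlas[OF d(1) e(1)])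
  ultimately show ?thesis using c V V' unfolding smooth_at_def by blast
qed

lemma smooth_at_proj:
  assumes "charted M" "charted N" "p \<in> topspace (mtop M) \<times> topspace (mtop N)"
  shows smooth_at_fst: "smooth_at (prod_mfd M N) M fst p"
    and smooth_at_snd: "smooth_at (prod_mfd M N) N snd p"
proof -
  obtain c where c: "c \<in> atlas M" "fst p \<in> fst c" 
    using charted_obtain[OF assms(1), of "fst p"] assms(3) by (auto simp: mem_Times_iff)
  obtain d where d: "d \<in> atlas N" "snd p \<in> fst d" 
    using charted_obtain[OF assms(2), of "snd p"] assms(3) by (auto simp: mem_Times_iff)
  let ?cd = "(fst c \<times> fst d, map_prod (snd c) (snd d))"
  have cd: "?cd \<in> atlas (prod_mfd M N)" "p \<in> fst ?cd" 
    using prod_chart_in_atlas[OF c(1) d(1)] c d by (simp_all add: mem_Times_iff)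
  note P = charted_prod[OF assms(1,2)]
  have o: "openin (mtop (prod_mfd M N)) (fst ?cd)" "open (snd ?cd ` fst ?cd)"
    using chartedD(1)[OF P cd(1)] charted_open_range[OF P cd(1)] by auto
  have i: "chart_inv ?cd (snd ?cd q) = q" if "q \<in> fst ?cd" for q
    using charted_inv[OF P cd(1) that] .
  have "smooth_on (snd ?cd ` fst ?cd) (\<lambda>u. snd c (fst (chart_inv ?cd u)))"
    by (rule smooth_on_cong[OF smooth_on_linear[OF bounded_linear_fst] o(2)]) (use i in auto)
  then have "smooth_in (prod_mfd M N) ?cd c fst (fst ?cd)" using o by (auto simp: smooth_in_def)
  then show "smooth_at (prod_mfd M N) M fst p" using cd c unfolding smooth_at_def by blast
  have "smooth_on (snd ?cd ` fst ?cd) (\<lambda>u. snd d (snd (chart_inv ?cd u)))"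
    by (rule smooth_on_cong[OF smooth_on_linear[OF bounded_linear_snd] o(2)]) (use i in auto)
  then have "smooth_in (prod_mfd M N) ?cd d snd (fst ?cd)" using o by (auto simp: smooth_in_def)
  then show "smooth_at (prod_mfd M N) N snd p" using cd d unfolding smooth_at_def by blast
qed

lemma smooth_at_chart:
  assumes "charted M" "c \<in> atlas M" "x \<in> fst c"
  shows "smooth_at M euc (snd c) x"
proof -
  have "smooth_on (snd c ` fst c) (\<lambda>u. snd c (chart_inv c u))"
    by (rule smooth_on_cong[OF smooth_on_ident]) (use assms in \<open>auto simp: charted_open_range f_inv_into_f\<close>)
  then have "smooth_in M c (UNIV, \<lambda>x. x) (snd c) (fst c)"
    using chartedD(1)[OF assms(1,2)] by (auto simp: smooth_in_def)
  then show ?thesis by (rule smooth_atI[OF assms(2), rotated -1]) (use assms in auto)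
qed

lemma smooth_at_chart_inv:
  assumes "charted M" "c \<in> atlas M" "u \<in> snd c ` fst c"
  shows "smooth_at euc M (chart_inv c) u"
proof -
  have "smooth_on (snd c ` fst c) (\<lambda>u. snd c (chart_inv c u))"
    by (rule smooth_on_cong[OF smooth_on_ident]) (use assms in \<open>auto simp: charted_open_range f_inv_into_f\<close>)
  then have "smooth_in euc (UNIV, \<lambda>x. x) c (chart_inv c) (snd c ` fst c)"
    using charted_open_range[OF assms(1,2)] by (auto simp: smooth_in_def inv_into_into)
  then show ?thesis by (rule smooth_atI[rotated -1]) (use assms in auto)
qed

lemma smooth_at_euc_iff: "smooth_at euc euc F u \<longleftrightarrow> (\<exists>U. open U \<and> u \<in> U \<and> smooth_on U F)"
  by (auto simp: smooth_at_def smooth_in_def)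

lemma smooth_at_openin:
  assumes "\<And>x. x \<in> S \<Longrightarrow> \<exists>V. openin T V \<and> x \<in> V \<and> V \<subseteq> S"
  shows "openin T S"
  using assms openin_subopen by metis

text \<open>Translates between the global definition, which ranges over all pairs of charts, and
  germs. All closure properties are proved for germs and reach \<open>smooth_map\<close> through
  this equivalence.\<close>

lemma smooth_map_iff:
  assumes M: "charted M" and N: "charted N"
  shows "smooth_map M N F \<longleftrightarrow> (\<forall>x\<in>topspace (mtop M). smooth_at M N F x)"
proof
  assume F: "smooth_map M N F"
  show "\<forall>x\<in>topspace (mtop M). smooth_at M N F x"
  proof
    fix x assume x: "x \<in> topspace (mtop M)"
    have cont: "continuous_map (mtop M) (mtop N) F" using F by (simp add: smooth_map_def)
    then have Fx: "F x \<in> topspace (mtop N)" using x by (auto simp: continuous_map_def)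
    obtain c where c: "c \<in> atlas M" "x \<in> fst c" using charted_obtain[OF M x] .
    obtain d where d: "d \<in> atlas N" "F x \<in> fst d" using charted_obtain[OF N Fx] .
    have "{z \<in> fst c. F z \<in> fst d} = fst c \<inter> {z \<in> topspace (mtop M). F z \<in> fst d}"
      using chartedD(5)[OF M c(1)] by auto
    then have "openin (mtop M) {z \<in> fst c. F z \<in> fst d}"
      using openin_Int[OF chartedD(1)[OF M c(1)]
          openin_continuous_map_preimage[OF cont chartedD(1)[OF N d(1)]]] by argo
    then have "smooth_in M c d F {z \<in> fst c. F z \<in> fst d}"
      using F c d by (auto simp: smooth_in_def smooth_map_def comp_def)
    then show "smooth_at M N F x" by (rule smooth_atI[OF c(1) d(1), rotated]) (use c d in simp)
  qed
next
  assume F: "\<forall>x\<in>topspace (mtop M). smooth_at M N F x"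
  have "continuous_map (mtop M) (mtop N) F"
    unfolding continuous_map_def
  proof (intro conjI allI impI)
    show "F \<in> topspace (mtop M) \<rightarrow> topspace (mtop N)" using F smooth_at_topspace[OF M N] by blast
    fix T assume "openin (mtop N) T"
    show "openin (mtop M) {x \<in> topspace (mtop M). F x \<in> T}"
    proof (rule smooth_at_openin)
      fix x assume "x \<in> {x \<in> topspace (mtop M). F x \<in> T}"
      then obtain V where "openin (mtop M) V" "x \<in> V" "\<And>z. z \<in> V \<Longrightarrow> F z \<in> T"
        using F smooth_at_open[OF M N _ \<open>openin (mtop N) T\<close>] by blast
      then show "\<exists>V. openin (mtop M) V \<and> x \<in> V \<and> V \<subseteq> {x \<in> topspace (mtop M). F x \<in> T}"
        using openin_subset by blast
    qed
  qed
  moreover have "smooth_on (snd c ` {x \<in> fst c. F x \<in> fst d}) (snd d \<circ> F \<circ> chart_inv c)"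
    if c: "c \<in> atlas M" and d: "d \<in> atlas N" for c d
  proof (rule smooth_on_local)
    fix p assume "p \<in> snd c ` {x \<in> fst c. F x \<in> fst d}"
    then obtain x where x: "p = snd c x" "x \<in> fst c" "F x \<in> fst d" by auto
    then obtain V where V: "x \<in> V" "smooth_in M c d F V"
      using smooth_at_in_charts[OF M N _ c d] F chartedD(5)[OF M c] by blast
    then show "\<exists>U. open U \<and> p \<in> U \<and> smooth_on U (snd d \<circ> F \<circ> chart_inv c)"
      using x charted_open_image[OF M c] by (auto simp: smooth_in_def comp_def)
  qed
  ultimately show "smooth_map M N F" by (simp add: smooth_map_def)
qed

lemma smooth_fun_on_iff:
  assumes M: "charted M"
  shows "smooth_fun_on M W h \<longleftrightarrow> openin (mtop M) W \<and> (\<forall>x\<in>W. smooth_at M euc h x)"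
proof
  assume h: "smooth_fun_on M W h"
  then have W: "openin (mtop M) W" by (simp add: smooth_fun_on_def)
  have "smooth_at M euc h x" if "x \<in> W" for x
  proof -
    obtain c where c: "c \<in> atlas M" "x \<in> fst c"
      using charted_obtain[OF M] \<open>x \<in> W\<close> W openin_subset by blast
    then have "smooth_in M c (UNIV, \<lambda>x. x) h (fst c \<inter> W)"
      using h W chartedD(1)[OF M c(1)] by (auto simp: smooth_fun_on_def smooth_in_def comp_def)
    then show ?thesis by (rule smooth_atI[OF c(1), rotated -1]) (use c that in auto)
  qed
  then show "openin (mtop M) W \<and> (\<forall>x\<in>W. smooth_at M euc h x)" using W by blast
next
  assume h: "openin (mtop M) W \<and> (\<forall>x\<in>W. smooth_at M euc h x)"
  have "smooth_on (snd c ` (fst c \<inter> W)) (h \<circ> chart_inv c)" if c: "c \<in> atlas M" for c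
  proof (rule smooth_on_local)
    fix p assume "p \<in> snd c ` (fst c \<inter> W)"
    then obtain x where x: "p = snd c x" "x \<in> fst c" "x \<in> W" by auto
    then obtain V where V: "x \<in> V" "smooth_in M c (UNIV, \<lambda>x. x) h V"
      using smooth_at_in_charts[OF M charted_euc _ c, of h x "(UNIV, \<lambda>x. x)"] h by auto
    then show "\<exists>U. open U \<and> p \<in> U \<and> smooth_on U (h \<circ> chart_inv c)"
      using x charted_open_image[OF M c] by (auto simp: smooth_in_def comp_def)
  qed
  then show "smooth_fun_on M W h" using h by (simp add: smooth_fun_on_def)
qed

section \<open>Vector fields in coordinates\<close>

lemma has_derivative_partial:
  assumes "(K has_derivative K') (at (a, b))"
  shows has_derivative_partial_fst: "((\<lambda>u. K (u, b)) has_derivative (\<lambda>v. K' (v, 0))) (at a)"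
    and has_derivative_partial_snd: "((\<lambda>u. K (a, u)) has_derivative (\<lambda>v. K' (0, v))) (at b)"
proof -
  show "((\<lambda>u. K (u, b)) has_derivative (\<lambda>v. K' (v, 0))) (at a)"
    by (rule has_derivative_compose[where f = "\<lambda>u. (u, b)" and g = K, OF _ assms])
      (intro has_derivative_Pair has_derivative_ident has_derivative_const)
  show "((\<lambda>u. K (a, u)) has_derivative (\<lambda>v. K' (0, v))) (at b)"
    by (rule has_derivative_compose[where f = "\<lambda>u. (a, u)" and g = K, OF _ assms])
      (intro has_derivative_Pair has_derivative_ident has_derivative_const)
qed

lemma linear_Pair_split: "linear L \<Longrightarrow> L (v, w) = L (v, 0) + L (0, w)"
  using linear_add[of L "(v, 0)" "(0, w)"] by simp

lemma smooth_at_Pair_euc: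
  "charted L \<Longrightarrow> smooth_at L euc F x \<Longrightarrow> smooth_at L euc H x \<Longrightarrow> smooth_at L euc (\<lambda>x. (F x, H x)) x"
  using smooth_at_Pair[of L euc euc F x H] by (simp add: prod_euc)

lemma smooth_at_euc_linear: "bounded_linear F \<Longrightarrow> smooth_at euc euc F u"
  unfolding smooth_at_euc_iff by (auto intro: exI[of _ UNIV] smooth_on_linear)

lemma smooth_at_euc_derivative:
  "smooth_at euc euc F u \<Longrightarrow> (F has_derivative frechet_derivative F (at u)) (at u)"
  unfolding smooth_at_euc_iff using smooth_on_has_derivative by blast

lemma smooth_at_nbhd:
  fixes h :: "'a \<Rightarrow> real"
  assumes "charted M" "smooth_at M euc h x"
  obtains W where "smooth_fun_on M W h" "x \<in> W"
  using smooth_at_eventually[OF assms(2)] smooth_fun_on_iff[OF assms(1)] by metis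

lemma smooth_at_coords:
  assumes "charted M" "charted N" "c \<in> atlas M" "x \<in> fst c" "smooth_at M N h x"
  shows "smooth_at euc N (\<lambda>u. h (chart_inv c u)) (snd c x)"
  using smooth_at_compose[OF charted_euc assms(1,2) smooth_at_chart_inv[OF assms(1,3)], of "snd c x"]
    assms(4,5) by (simp add: charted_inv[OF assms(1,3,4)])

text \<open>By linearity of the derivative, the sum over \<open>Basis\<close> collapses to a single
  derivative in the direction \<open>\<xi>\<close>; the germ formulation removes the domain
  \<open>W\<close>.\<close>

lemma vector_field_coords:
  fixes M :: "('a, 'e::euclidean_space) mfd"
  assumes M: "charted M" and "vector_field M \<delta>" and c: "c \<in> atlas M"
  obtains \<xi> :: "'e \<Rightarrow> 'e" where "smooth_on (snd c ` fst c) \<xi>"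
    "\<And>h x. x \<in> fst c \<Longrightarrow> smooth_at M euc h x \<Longrightarrow>
      \<delta> h x = frechet_derivative (\<lambda>u. h (chart_inv c u)) (at (snd c x)) (\<xi> (snd c x))"
proof -
  obtain \<xi> :: "'e \<Rightarrow> 'e" where \<xi>: "smooth_on (snd c ` fst c) \<xi>"
    "\<And>W h x. smooth_fun_on M W h \<Longrightarrow> x \<in> fst c \<inter> W \<Longrightarrow>
      \<delta> h x = (\<Sum>i\<in>Basis. (\<xi> (snd c x) \<bullet> i) * coord_deriv c i h x)"
    using assms unfolding vector_field_def by meson
  show thesis
  proof (rule that[OF \<xi>(1)])
    fix h :: "'a \<Rightarrow> real" and x assume x: "x \<in> fst c" and h: "smooth_at M euc h x"
    obtain W where W: "smooth_fun_on M W h" "x \<in> W" using smooth_at_nbhd[OF M h] .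
    let ?L = "frechet_derivative (\<lambda>u. h (chart_inv c u)) (at (snd c x))"
    have "linear ?L"
      using smooth_at_euc_derivative[OF smooth_at_coords[OF M charted_euc c x h]]
      by (rule has_derivative_linear)
    then show "\<delta> h x = ?L (\<xi> (snd c x))"
      using \<xi>(2)[OF W(1)] x W(2) linear_euclidean_expand[of ?L "\<xi> (snd c x)"]
      by (simp add: coord_deriv_def comp_def)
  qed
qed

text \<open>The operator receives total functions, but its coordinate formula only sees a
  derivative, hence only the germ at \<open>x\<close>.\<close>

lemma vector_field_cong:
  assumes M: "charted M" and \<delta>: "vector_field M \<delta>" and h: "smooth_at M euc h x"
    and V: "openin (mtop M) V" "x \<in> V" "\<And>z. z \<in> V \<Longrightarrow> h z = k z"
  shows "\<delta> h x = \<delta> k x"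
proof -
  have k: "smooth_at M euc k x" by (rule smooth_at_cong[OF M h V])
  obtain c where c: "c \<in> atlas M" "x \<in> fst c"
    using charted_obtain[OF M smooth_at_topspace(1)[OF M charted_euc h]] .
  obtain \<xi> where \<xi>: "\<And>h x. x \<in> fst c \<Longrightarrow> smooth_at M euc h x \<Longrightarrow>
      \<delta> h x = frechet_derivative (\<lambda>u. h (chart_inv c u)) (at (snd c x)) (\<xi> (snd c x))"
    using vector_field_coords[OF M \<delta> c(1)] by metis
  have "frechet_derivative (\<lambda>u. h (chart_inv c u)) (at (snd c x)) =
      frechet_derivative (\<lambda>u. k (chart_inv c u)) (at (snd c x))"
  proof (rule frechet_derivative_transform_within_open)
    show "(\<lambda>u. h (chart_inv c u)) differentiable at (snd c x)"
      using smooth_at_euc_derivative[OF smooth_at_coords[OF M charted_euc c h]] differentiableI by blast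
    show "open (snd c ` (fst c \<inter> V))" using chartedD(3)[OF M c(1) V(1)] .
  qed (use c V charted_inv[OF M c(1)] in auto)
  then show ?thesis using \<xi>[OF c(2) h] \<xi>[OF c(2) k] by simp
qed

lemma vector_field_const:
  assumes M: "charted M" and \<delta>: "vector_field M \<delta>" and x: "x \<in> topspace (mtop M)"
  shows "\<delta> (\<lambda>z. r) x = 0"
proof -
  obtain c where c: "c \<in> atlas M" "x \<in> fst c" using charted_obtain[OF M x] .
  obtain \<xi> where "\<And>h x. x \<in> fst c \<Longrightarrow> smooth_at M euc h x \<Longrightarrow>
      \<delta> h x = frechet_derivative (\<lambda>u. h (chart_inv c u)) (at (snd c x)) (\<xi> (snd c x))"
    using vector_field_coords[OF M \<delta> c(1)] by metis
  from this[OF c(2) smooth_at_const[OF M charted_euc x]] show ?thesis by simp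
qed

text \<open>Needed because the bracket differentiates \<open>\<delta> k\<close> once more, along the
  generators.\<close>

lemma vector_field_smooth:
  assumes M: "charted M" and \<delta>: "vector_field M \<delta>" and h: "smooth_at M euc h x"
  shows "smooth_at M euc (\<delta> h) x"
proof -
  obtain c where c: "c \<in> atlas M" "x \<in> fst c"
    using charted_obtain[OF M smooth_at_topspace(1)[OF M charted_euc h]] .
  obtain \<xi> where \<xi>: "smooth_on (snd c ` fst c) \<xi>" "\<And>h x. x \<in> fst c \<Longrightarrow> smooth_at M euc h x \<Longrightarrow>
      \<delta> h x = frechet_derivative (\<lambda>u. h (chart_inv c u)) (at (snd c x)) (\<xi> (snd c x))"
    using vector_field_coords[OF M \<delta> c(1)] by metis
  obtain W where W: "openin (mtop M) W" "x \<in> W" "\<And>z. z \<in> W \<Longrightarrow> smooth_at M euc h z"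
    using smooth_at_eventually[OF h] by blast
  let ?U = "snd c ` (fst c \<inter> W)"
  let ?g = "\<lambda>u. frechet_derivative (\<lambda>u. h (chart_inv c u)) (at u) (\<xi> u)"
  have "open ?U" using chartedD(3)[OF M c(1) W(1)] .
  moreover have "smooth_on ?U (\<lambda>u. h (chart_inv c u))"
    using smooth_fun_on_iff[OF M, of W h] W c by (auto simp: smooth_fun_on_def comp_def)
  ultimately have "smooth_on ?U ?g"
    by (intro smooth_on_frechet_apply smooth_on_subset[OF \<xi>(1)]) auto
  then have "smooth_at euc euc ?g (snd c x)"
    unfolding smooth_at_euc_iff using \<open>open ?U\<close> c W by blast
  then have "smooth_at M euc (\<lambda>z. ?g (snd c z)) x"
    using smooth_at_compose[OF M charted_euc charted_euc smooth_at_chart[OF M c]] by blast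
  then show ?thesis
    by (rule smooth_at_cong[OF M _ openin_Int[OF chartedD(1)[OF M c(1)] W(1)]])
      (use c W \<xi>(2) in auto)
qed

text \<open>Chain rule on the diagonal: the direction \<open>(\<xi>, \<xi>)\<close> splits as
  \<open>(\<xi>, 0) + (0, \<xi>)\<close>. It merges the two summands of \<open>extend_vf\<close>
  into one derivative, once both are taken at the same point.\<close>

lemma vector_field_diagonal:
  assumes M: "charted M" and \<delta>: "vector_field M \<delta>" and H: "smooth_at (prod_mfd M M) euc H (x, x)"
  shows "\<delta> (\<lambda>z. H (z, z)) x = \<delta> (\<lambda>z. H (z, x)) x + \<delta> (\<lambda>z. H (x, z)) x"
proof -
  have x: "x \<in> topspace (mtop M)"
    using smooth_at_topspace(1)[OF charted_prod[OF M M] charted_euc H] by simp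
  obtain c where c: "c \<in> atlas M" "x \<in> fst c" using charted_obtain[OF M x] .
  obtain \<xi> where \<xi>: "\<And>h x. x \<in> fst c \<Longrightarrow> smooth_at M euc h x \<Longrightarrow>
      \<delta> h x = frechet_derivative (\<lambda>u. h (chart_inv c u)) (at (snd c x)) (\<xi> (snd c x))"
    using vector_field_coords[OF M \<delta> c(1)] by metis
  let ?u = "snd c x"
  let ?K = "\<lambda>p. H (chart_inv c (fst p), chart_inv c (snd p))"
  have inv: "chart_inv c ?u = x" using charted_inv[OF M c] .
  have id: "smooth_at M M (\<lambda>z. z) x" and const: "smooth_at M M (\<lambda>z. x) x"
    using x M by (auto intro: smooth_at_ident smooth_at_const)
  have sm: "smooth_at M euc (\<lambda>z. H (z, z)) x" "smooth_at M euc (\<lambda>z. H (z, x)) x"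
    "smooth_at M euc (\<lambda>z. H (x, z)) x"
    by (rule smooth_at_compose'[OF M charted_prod[OF M M] charted_euc _ H],
        rule smooth_at_Pair[OF M M M], rule id const, rule id const, rule refl)+
  have sm': "smooth_at euc M (\<lambda>p. chart_inv c (fst p)) (?u, ?u)"
    "smooth_at euc M (\<lambda>p. chart_inv c (snd p)) (?u, ?u)"
    using c smooth_at_compose[OF charted_euc charted_euc M
        smooth_at_euc_linear[OF bounded_linear_fst] smooth_at_chart_inv[OF M c(1)], of "(?u, ?u)"]
      smooth_at_compose[OF charted_euc charted_euc M
        smooth_at_euc_linear[OF bounded_linear_snd] smooth_at_chart_inv[OF M c(1)], of "(?u, ?u)"]
    by auto
  have "smooth_at euc euc ?K (?u, ?u)"
    by (rule smooth_at_compose'[OF charted_euc charted_prod[OF M M] charted_euc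
          smooth_at_Pair[OF charted_euc M M sm'] H]) (simp add: inv)
  then obtain K' where K': "(?K has_derivative K') (at (?u, ?u))"
    using smooth_at_euc_derivative by blast
  have "((\<lambda>u. ?K (u, u)) has_derivative (\<lambda>v. K' (v, v))) (at ?u)"
    by (rule has_derivative_compose[where f = "\<lambda>u. (u, u)" and g = ?K, OF _ K'])
      (intro has_derivative_Pair has_derivative_ident)
  from frechet_derivative_eqI[OF this] have 1: "\<delta> (\<lambda>z. H (z, z)) x = K' (\<xi> ?u, \<xi> ?u)"
    by (simp add: \<xi>[OF c(2) sm(1)])
  from frechet_derivative_eqI[OF has_derivative_partial_fst[OF K']]
  have 2: "\<delta> (\<lambda>z. H (z, x)) x = K' (\<xi> ?u, 0)" by (simp add: \<xi>[OF c(2) sm(2)] inv)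
  from frechet_derivative_eqI[OF has_derivative_partial_snd[OF K']]
  have 3: "\<delta> (\<lambda>z. H (x, z)) x = K' (0, \<xi> ?u)" by (simp add: \<xi>[OF c(2) sm(3)] inv)
  show ?thesis unfolding 1 2 3 by (rule linear_Pair_split[OF has_derivative_linear[OF K']])
qed

section \<open>Functions with vanishing derivative on a connected manifold\<close>

lemma constant_if_derivative_zero:
  fixes F :: "'a \<Rightarrow> real"
  assumes M: "charted M" and conn: "connected_space (mtop M)"
    and F: "\<And>c u. c \<in> atlas M \<Longrightarrow> u \<in> snd c ` fst c \<Longrightarrow>
      ((\<lambda>u. F (chart_inv c u)) has_derivative (\<lambda>v. 0)) (at u)"
    and "x \<in> topspace (mtop M)" "y \<in> topspace (mtop M)"
  shows "F x = F y"
proof -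
  have loc: "\<exists>V. openin (mtop M) V \<and> x \<in> V \<and> (\<forall>z\<in>V. F z = F x)" if x: "x \<in> topspace (mtop M)" for x
  proof -
    obtain c where c: "c \<in> atlas M" "x \<in> fst c" using charted_obtain[OF M x] .
    obtain e where e: "e > 0" "ball (snd c x) e \<subseteq> snd c ` fst c"
      using charted_open_range[OF M c(1)] c(2) by (meson imageI openE)
    \<comment> \<open>The ball is convex, which makes a function with zero derivative constant on
      it; the chart range itself may be disconnected.\<close>
    have "\<exists>r. \<forall>u\<in>ball (snd c x) e. F (chart_inv c u) = r"
      by (rule has_derivative_zero_constant)
        (use e(2) has_derivative_at_withinI[OF F[OF c(1)]] in auto)
    then have *: "F (chart_inv c u) = F x" if "u \<in> ball (snd c x) e" for u
      using that e(1) charted_inv[OF M c] by (metis centre_in_ball)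
    show ?thesis
    proof (intro exI[of _ "{z \<in> fst c. snd c z \<in> ball (snd c x) e}"] conjI ballI)
      show "openin (mtop M) {z \<in> fst c. snd c z \<in> ball (snd c x) e}"
        by (intro chartedD(4)[OF M c(1)]) simp
      fix z assume "z \<in> {z \<in> fst c. snd c z \<in> ball (snd c x) e}"
      then show "F z = F x" using *[of "snd c z"] charted_inv[OF M c(1), of z] by simp
    qed (use c e in simp)
  qed
  let ?A = "{z \<in> topspace (mtop M). F z = F x}" and ?B = "{z \<in> topspace (mtop M). F z \<noteq> F x}"
  \<comment> \<open>For a locally constant \<open>F\<close>, every condition on its value is open.
    Taking equality with \<open>F x\<close> and its negation splits the space into two open
    sets.\<close>
  have op: "openin (mtop M) {z \<in> topspace (mtop M). Q (F z)}" for Q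
  proof (rule smooth_at_openin)
    fix z assume z: "z \<in> {z \<in> topspace (mtop M). Q (F z)}"
    then have "z \<in> topspace (mtop M)" by simp
    from loc[OF this] obtain V where V: "openin (mtop M) V" "z \<in> V" "\<forall>w\<in>V. F w = F z" by blast
    have "w \<in> topspace (mtop M) \<and> Q (F w)" if "w \<in> V" for w
      using subsetD[OF openin_subset[OF V(1)] that] bspec[OF V(3) that] z by simp
    then have "V \<subseteq> {z \<in> topspace (mtop M). Q (F z)}" by blast
    then show "\<exists>V. openin (mtop M) V \<and> z \<in> V \<and> V \<subseteq> {z \<in> topspace (mtop M). Q (F z)}"
      using V by blast
  qed
  have "openin (mtop M) ?A" "openin (mtop M) ?B"
    using op[of "\<lambda>r. r = F x"] op[of "\<lambda>r. r \<noteq> F x"] by simp_all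
  moreover have "topspace (mtop M) \<subseteq> ?A \<union> ?B" "?A \<inter> ?B = {}" by auto
  moreover have "?A \<noteq> {}" using assms(4) by blast
  ultimately have "?B = {}" using conn unfolding connected_space_def by meson
  then show ?thesis using assms(5) by fastforce
qed

section \<open>Lie group actions\<close>

locale smooth_group =
  fixes G (structure) and GM :: "('g, 'p::euclidean_space) mfd"
  assumes lie_group: "lie_group G GM"
begin

sublocale group G
  using lie_group by (simp add: lie_group_def)

lemma charted_group: "charted GM"
  using lie_group by (simp add: lie_group_def smooth_manifold_charted)

lemma topspace_group: "topspace (mtop GM) = carrier G"
  using lie_group by (simp add: lie_group_def)

lemma chart_carrier: "c \<in> atlas GM \<Longrightarrow> a \<in> fst c \<Longrightarrow> a \<in> carrier G"
  using chartedD(5)[OF charted_group] topspace_group by blast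

lemma smooth_at_mult:
  assumes M: "charted M" and "smooth_at M GM A x" "smooth_at M GM B x"
  shows "smooth_at M GM (\<lambda>z. A z \<otimes> B z) x"
proof -
  note P = charted_prod[OF charted_group charted_group]
  have m: "smooth_at (prod_mfd GM GM) GM (\<lambda>(a, b). a \<otimes> b) p" if "p \<in> carrier G \<times> carrier G" for p
    using lie_group that smooth_map_iff[OF P charted_group]
    by (auto simp: lie_group_def topspace_group)
  have "(A x, B x) \<in> carrier G \<times> carrier G"
    using smooth_at_topspace(2)[OF M charted_group] assms(2,3) by (auto simp: topspace_group)
  from smooth_at_compose'[OF M P charted_group
      smooth_at_Pair[OF M charted_group charted_group assms(2,3)] m[OF this] refl]
  show ?thesis by simp
qed

lemma smooth_at_inv:
  assumes M: "charted M" and A: "smooth_at M GM A x"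
  shows "smooth_at M GM (\<lambda>z. inv (A z)) x"
proof -
  have "smooth_at GM GM (\<lambda>a. inv a) (A x)"
    using lie_group smooth_map_iff[OF charted_group charted_group]
      smooth_at_topspace(2)[OF M charted_group A]
    by (auto simp: lie_group_def)
  from smooth_at_compose[OF M charted_group charted_group A this] show ?thesis .
qed

end

locale smooth_action = smooth_group G GM
  for G (structure) and GM :: "('g, 'p::euclidean_space) mfd" +
  fixes X :: "('x, 'e::euclidean_space) mfd" and f :: "'x \<Rightarrow> 'g \<Rightarrow> 'x"
  assumes charted_space: "charted X" and lie_action: "lie_action G GM X f"
begin

abbreviation "S \<equiv> topspace (mtop X)"

lemma act_group_action: "group_action G S (\<lambda>a. restrict (\<lambda>x. f x a) S)"
  using lie_action by (simp add: lie_action_def)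

lemma act_closed: "x \<in> S \<Longrightarrow> a \<in> carrier G \<Longrightarrow> f x a \<in> S"
  using group_action.element_image[OF act_group_action, of a x "f x a"] by simp

lemma act_one: "x \<in> S \<Longrightarrow> f x \<one> = x"
  using fun_cong[OF group_action.id_eq_one[OF act_group_action], of x] by simp

lemma act_mult: "x \<in> S \<Longrightarrow> a \<in> carrier G \<Longrightarrow> b \<in> carrier G \<Longrightarrow> f (f x a) b = f x (b \<otimes> a)"
  using group_action.composition_rule[OF act_group_action, of x b a] act_closed by simp

lemma smooth_at_act:
  assumes M: "charted M" and "smooth_at M X F x" "smooth_at M GM A x"
  shows "smooth_at M X (\<lambda>z. f (F z) (A z)) x"
proof -
  note P = charted_prod[OF charted_space charted_group]
  have m: "smooth_at (prod_mfd X GM) X (\<lambda>(x, a). f x a) p" if "p \<in> S \<times> carrier G" for p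
    using lie_action that smooth_map_iff[OF P charted_space]
    by (auto simp: lie_action_def topspace_group)
  have "(F x, A x) \<in> S \<times> carrier G"
    using smooth_at_topspace(2)[OF M charted_space] smooth_at_topspace(2)[OF M charted_group] assms(2,3)
    by (auto simp: topspace_group)
  from smooth_at_compose'[OF M P charted_space
      smooth_at_Pair[OF M charted_space charted_group assms(2,3)] m[OF this] refl]
  show ?thesis by simp
qed

lemma smooth_at_translate:
  fixes h :: "'x \<Rightarrow> real"
  assumes "x \<in> S" "a \<in> carrier G" "smooth_at X euc h (f x a)"
  shows "smooth_at X euc (\<lambda>z. h (f z a)) x"
proof -
  have "smooth_at X X (\<lambda>z. f z a) x"
    using assms by (intro smooth_at_act smooth_at_ident smooth_at_const)
      (auto simp: charted_space charted_group topspace_group)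
  from smooth_at_compose[OF charted_space charted_space charted_euc this assms(3)] show ?thesis .
qed

end

section \<open>Infinitesimal generators in coordinates around the identity\<close>

locale smooth_action_at_one = smooth_action G GM X f
  for G (structure) and GM :: "('g, 'p::euclidean_space) mfd"
    and X :: "('x, 'e::euclidean_space) mfd" and f +
  fixes c0 :: "('g, 'p) chart"
  assumes c0: "c0 \<in> atlas GM" "\<one> \<in> fst c0"
begin

abbreviation "s0 \<equiv> snd c0 \<one>"
abbreviation "gen \<equiv> inf_generator G c0 f"

lemma c0_one: "chart_inv c0 s0 = \<one>"
  using charted_inv[OF charted_group c0] .

lemma smooth_at_c0_inv: "smooth_at euc GM (chart_inv c0) s0"
  using c0 by (intro smooth_at_chart_inv charted_group) auto

lemma gen_eq: "gen \<tau> k x = frechet_derivative (\<lambda>s. k (f x (chart_inv c0 s))) (at s0) \<tau>"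
  by (simp add: inf_generator_def coord_deriv_def comp_def)

text \<open>Smoothness jointly in the point and the group parameters; the mixed derivatives behind
  the bracket are taken of this function.\<close>

lemma smooth_at_coord_act:
  fixes k :: "'x \<Rightarrow> real"
  assumes e: "e \<in> atlas X" "y \<in> fst e" and k: "smooth_at X euc k y"
  shows "smooth_at euc euc (\<lambda>p. k (f (chart_inv e (fst p)) (chart_inv c0 (snd p)))) (snd e y, s0)"
proof -
  have y: "chart_inv e (snd e y) = y" "y \<in> S"
    using charted_inv[OF charted_space e] chartedD(5)[OF charted_space e] by auto
  have "smooth_at euc X (\<lambda>p. chart_inv e (fst p)) (snd e y, s0)"
    by (rule smooth_at_compose'[OF charted_euc charted_euc charted_space
          smooth_at_euc_linear[OF bounded_linear_fst]
          smooth_at_chart_inv[OF charted_space e(1) imageI[OF e(2)]]]) simp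
  moreover have "smooth_at euc GM (\<lambda>p. chart_inv c0 (snd p)) (snd e y, s0)"
    by (rule smooth_at_compose'[OF charted_euc charted_euc charted_group
          smooth_at_euc_linear[OF bounded_linear_snd] smooth_at_c0_inv]) simp
  ultimately have "smooth_at euc X (\<lambda>p. f (chart_inv e (fst p)) (chart_inv c0 (snd p))) (snd e y, s0)"
    by (rule smooth_at_act[OF charted_euc])
  from smooth_at_compose'[OF charted_euc charted_space charted_euc this k] y
  show ?thesis by (simp add: c0_one act_one)
qed

text \<open>In coordinates, \<open>gen \<tau> k\<close> is the partial derivative in the direction
  \<open>(0, \<tau>)\<close> of a jointly smooth function, restricted to the slice
  \<open>s = s0\<close>.\<close>

lemma gen_smooth:
  assumes k: "smooth_at X euc k y"
  shows "smooth_at X euc (gen \<tau> k) y"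
proof -
  have "y \<in> S" by (rule smooth_at_topspace(1)[OF charted_space charted_euc k])
  then obtain e where e: "e \<in> atlas X" "y \<in> fst e" by (rule charted_obtain[OF charted_space])
  let ?K = "\<lambda>p. k (f (chart_inv e (fst p)) (chart_inv c0 (snd p)))"
  obtain U where U: "open U" "(snd e y, s0) \<in> U" "smooth_on U ?K"
    using smooth_at_coord_act[OF e k] unfolding smooth_at_euc_iff by blast
  let ?D = "\<lambda>p. frechet_derivative ?K (at p) (0, \<tau>)"
  have D: "smooth_at euc euc ?D p" if "p \<in> U" for p
    using smooth_on_frechet[OF U(3)] U(1) that unfolding smooth_at_euc_iff by blast
  have emb: "smooth_at X euc (\<lambda>z. (snd e z, s0)) y"
    by (rule smooth_at_Pair_euc[OF charted_space smooth_at_chart[OF charted_space e]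
        smooth_at_const[OF charted_space charted_euc \<open>y \<in> S\<close>]]) simp
  have 1: "smooth_at X euc (\<lambda>z. ?D (snd e z, s0)) y"
    by (rule smooth_at_compose[OF charted_space charted_euc charted_euc emb D[OF U(2)]])
  obtain V where V: "openin (mtop X) V" "y \<in> V" "\<And>z. z \<in> V \<Longrightarrow> (snd e z, s0) \<in> U"
    using smooth_at_open[OF charted_space charted_euc emb, of U] U by auto
  have 2: "?D (snd e z, s0) = gen \<tau> k z" if "z \<in> fst e" "z \<in> V" for z
    using frechet_derivative_eqI[OF has_derivative_partial_snd[OF
        smooth_on_has_derivative[OF U(3) V(3)[OF that(2)]]], of \<tau>]
    by (simp add: gen_eq charted_inv[OF charted_space e(1) that(1)])
  show ?thesis
    by (rule smooth_at_cong[OF charted_space 1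
          openin_Int[OF chartedD(1)[OF charted_space e(1)] V(1)]]) (use e(2) V(2) 2 in simp_all)
qed

text \<open>The derivative of the inversion at the identity is minus the identity, as seen by
  differentiating \<open>g (a (a\<^sup>-\<^sup>1 y)) = g y\<close> in the two occurrences of \<open>a\<close> separately.\<close>

lemma gen_inv:
  assumes g: "smooth_at X euc g y"
  shows "frechet_derivative (\<lambda>s. g (f y (inv (chart_inv c0 s)))) (at s0) \<tau> = - gen \<tau> g y"
proof -
  have y: "y \<in> S" by (rule smooth_at_topspace(1)[OF charted_space charted_euc g])
  let ?P = "\<lambda>p. g (f (f y (inv (chart_inv c0 (snd p)))) (chart_inv c0 (fst p)))"
  have A: "smooth_at euc GM (\<lambda>p. chart_inv c0 (fst p)) (s0, s0)"
    by (rule smooth_at_compose'[OF charted_euc charted_euc charted_group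
          smooth_at_euc_linear[OF bounded_linear_fst] smooth_at_c0_inv]) simp
  have B: "smooth_at euc GM (\<lambda>p. chart_inv c0 (snd p)) (s0, s0)"
    by (rule smooth_at_compose'[OF charted_euc charted_euc charted_group
          smooth_at_euc_linear[OF bounded_linear_snd] smooth_at_c0_inv]) simp
  have "smooth_at euc X (\<lambda>p. f (f y (inv (chart_inv c0 (snd p)))) (chart_inv c0 (fst p))) (s0, s0)"
    by (rule smooth_at_act[OF charted_euc smooth_at_act[OF charted_euc
          smooth_at_const[OF charted_euc charted_space _ y] smooth_at_inv[OF charted_euc B]] A]) simp
  from smooth_at_compose'[OF charted_euc charted_space charted_euc this g]
  have "smooth_at euc euc ?P (s0, s0)" by (simp add: c0_one act_one y)
  then obtain P' where P': "(?P has_derivative P') (at (s0, s0))"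
    using smooth_at_euc_derivative by blast
  have diag: "((\<lambda>s. ?P (s, s)) has_derivative (\<lambda>v. P' (v, v))) (at s0)"
    by (rule has_derivative_compose[where f = "\<lambda>u. (u, u)" and g = ?P, OF _ P'])
      (intro has_derivative_Pair has_derivative_ident)
  have "?P (s, s) = g y" if "s \<in> snd c0 ` fst c0" for s
  proof -
    have a: "chart_inv c0 s \<in> carrier G" by (rule chart_carrier[OF c0(1) inv_into_into[OF that]])
    show ?thesis by (simp add: a act_mult[OF y] act_one[OF y])
  qed
  then have "((\<lambda>s. g y) has_derivative (\<lambda>v. P' (v, v))) (at s0)"
    by (rule has_derivative_transform_within_open[OF diag charted_open_range[OF charted_group c0(1)]
        imageI[OF c0(2)]])
  from frechet_derivative_eqI[OF this, of \<tau>] have 1: "P' (\<tau>, \<tau>) = 0" by simp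
  from frechet_derivative_eqI[OF has_derivative_partial_fst[OF P'], of \<tau>]
  have 2: "gen \<tau> g y = P' (\<tau>, 0)" by (simp add: gen_eq c0_one act_one y)
  have "f y (inv (chart_inv c0 s)) \<in> S" if "s \<in> snd c0 ` fst c0" for s
    by (rule act_closed[OF y inv_closed[OF chart_carrier[OF c0(1) inv_into_into[OF that]]]])
  then have "((\<lambda>s. g (f y (inv (chart_inv c0 s)))) has_derivative (\<lambda>v. P' (0, v))) (at s0)"
    by (intro has_derivative_transform_within_open[OF has_derivative_partial_snd[OF P']
        charted_open_range[OF charted_group c0(1)] imageI[OF c0(2)]]) (simp add: c0_one act_one)
  from frechet_derivative_eqI[OF this, of \<tau>]
  have 3: "frechet_derivative (\<lambda>s. g (f y (inv (chart_inv c0 s)))) (at s0) \<tau> = P' (0, \<tau>)" .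
  show ?thesis
    using 1 linear_Pair_split[OF has_derivative_linear[OF P'], of \<tau> \<tau>] unfolding 2 3 by linarith
qed

end

section \<open>Invariance of the reciprocal distribution under translations\<close>

context smooth_action_at_one
begin

text \<open>In coordinates \<open>K(u, s) = k(f u s)\<close>, the function is \<open>Q(m s, s)\<close> with \<open>Q(u, s) = \<partial>\<^sub>uK(u, s) \<xi>(u)\<close>
  and \<open>m s\<close> the coordinates of \<open>s\<^sup>-\<^sup>1 y\<close>. The derivative through \<open>m\<close> is \<open>- \<theta> (\<delta> k) y\<close>, the one
  through the second argument is \<open>\<delta> (\<theta> k) y\<close> by the symmetry of the second derivative of \<open>K\<close>.\<close>

lemma transport_derivative_zero:
  assumes \<delta>: "vector_field X \<delta>" "\<And>\<tau>. \<tau> \<in> Basis \<Longrightarrow> vf_commute X \<delta> (gen \<tau>)"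
    and k: "smooth_at X euc k y"
  shows "((\<lambda>s. \<delta> (\<lambda>z. k (f z (chart_inv c0 s))) (f y (inv (chart_inv c0 s)))) has_derivative (\<lambda>w. 0)) (at s0)"
proof -
  have y: "y \<in> S" by (rule smooth_at_topspace(1)[OF charted_space charted_euc k])
  then obtain e where e: "e \<in> atlas X" "y \<in> fst e" by (rule charted_obtain[OF charted_space])
  obtain \<xi> where \<xi>: "smooth_on (snd e ` fst e) \<xi>" "\<And>h x. x \<in> fst e \<Longrightarrow> smooth_at X euc h x \<Longrightarrow>
      \<delta> h x = frechet_derivative (\<lambda>u. h (chart_inv e u)) (at (snd e x)) (\<xi> (snd e x))"
    using vector_field_coords[OF charted_space \<delta>(1) e(1)] by metis
  define u0 where "u0 = snd e y"
  define K where "K = (\<lambda>p. k (f (chart_inv e (fst p)) (chart_inv c0 (snd p))))"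
  define m where "m = (\<lambda>s. snd e (f y (inv (chart_inv c0 s))))"
  define Q where "Q = (\<lambda>p. frechet_derivative K (at p) (\<xi> (fst p), 0))"
  have eu: "chart_inv e u0 = y" unfolding u0_def by (rule charted_inv[OF charted_space e])
  have "smooth_at euc euc K (u0, s0)"
    using smooth_at_coord_act[OF e k] by (simp add: K_def u0_def)
  then obtain U where U: "open U" "(u0, s0) \<in> U" "smooth_on U K"
    unfolding smooth_at_euc_iff by blast
  have K': "(K has_derivative frechet_derivative K (at p)) (at p)" if "p \<in> U" for p
    by (rule smooth_on_has_derivative[OF U(3) that])
  \<comment> \<open>The coefficients \<open>\<xi>\<close> are smooth on the range of the chart
    \<open>e\<close> only, so the first coordinate is confined to it.\<close>
  define T where "T = U \<inter> (snd e ` fst e) \<times> UNIV"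
  have T: "open T" "(u0, s0) \<in> T" "T \<subseteq> U" "fst ` T \<subseteq> snd e ` fst e"
    using U e charted_open_range[OF charted_space e(1)] by (auto simp: T_def u0_def intro: open_Times)
  have "smooth_on T (\<lambda>p. \<xi> (fst p))"
    by (rule smooth_on_compose[OF \<xi>(1) smooth_on_linear[OF bounded_linear_fst] T(4,1)])
  then have "smooth_on T Q" unfolding Q_def
    by (intro smooth_on_frechet_apply smooth_on_subset[OF U(3) T(3)] smooth_on_Pair smooth_on_const T(1))
  then obtain Q' where Q': "(Q has_derivative Q') (at (u0, s0))"
    using smooth_on_has_derivative T(2) by blast
  have act: "smooth_at euc X (\<lambda>s. f y (inv (chart_inv c0 s))) s0"
    using y by (intro smooth_at_act smooth_at_inv smooth_at_c0_inv smooth_at_const)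
      (auto simp: charted_space)
  have m0: "m s0 = u0" by (simp add: m_def u0_def c0_one act_one[OF y])
  have "smooth_at euc euc m s0" unfolding m_def
    by (rule smooth_at_compose'[OF charted_euc charted_space charted_euc act
          smooth_at_chart[OF charted_space e]]) (simp add: c0_one act_one[OF y])
  then obtain m' where m': "(m has_derivative m') (at s0)"
    and pair: "smooth_at euc euc (\<lambda>s. (m s, s)) s0"
    using smooth_at_euc_derivative smooth_at_Pair_euc[OF charted_euc _ smooth_at_ident] by fastforce
  have QD: "((\<lambda>s. Q (m s, s)) has_derivative (\<lambda>w. Q' (m' w, w))) (at s0)"
    by (rule has_derivative_compose[where f = "\<lambda>s. (m s, s)" and g = Q])
      (auto simp: m0 intro!: has_derivative_Pair m' has_derivative_ident Q')
  obtain A where A: "open A" "s0 \<in> A" "\<And>s. s \<in> A \<Longrightarrow> (m s, s) \<in> T"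
    using smooth_at_open[OF charted_euc charted_euc pair, of T] T(1,2) by (auto simp: m0)
  obtain B where B: "open B" "s0 \<in> B" "\<And>s. s \<in> B \<Longrightarrow> f y (inv (chart_inv c0 s)) \<in> fst e"
    using smooth_at_open[OF charted_euc charted_space act chartedD(1)[OF charted_space e(1)]] e(2)
    by (auto simp: c0_one act_one[OF y])
  \<comment> \<open>For \<open>s\<close> in \<open>N\<close>, the pair \<open>(m s, s)\<close> stays
    in \<open>T\<close>, the moved point stays in the domain of \<open>e\<close>, and
    \<open>chart_inv c0 s\<close> is a group element.\<close>
  define N where "N = A \<inter> B \<inter> snd c0 ` fst c0"
  have N: "open N" "s0 \<in> N"
    using A B c0 charted_open_range[OF charted_group c0(1)] by (auto simp: N_def)
  have em: "chart_inv e (m s) = f y (inv (chart_inv c0 s))" if "s \<in> N" for s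
    unfolding m_def by (rule charted_inv[OF charted_space e(1)]) (use that B(3) N_def in auto)
  have car: "chart_inv c0 s \<in> carrier G" if "s \<in> N" for s
    by (rule chart_carrier[OF c0(1) inv_into_into]) (use that in \<open>simp add: N_def\<close>)
  have FQ: "Q (m s, s) = \<delta> (\<lambda>z. k (f z (chart_inv c0 s))) (f y (inv (chart_inv c0 s)))" if s: "s \<in> N" for s
  proof -
    let ?a = "chart_inv c0 s"
    let ?z = "f y (inv ?a)"
    have z: "?z \<in> S" "f ?z ?a = y" using y car[OF s] by (auto simp: act_closed act_mult act_one)
    have "smooth_at X euc (\<lambda>z. k (f z ?a)) ?z"
      by (rule smooth_at_translate[OF z(1) car[OF s]]) (simp add: z k)
    then have "\<delta> (\<lambda>z. k (f z ?a)) ?z =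
        frechet_derivative (\<lambda>u. k (f (chart_inv e u) ?a)) (at (m s)) (\<xi> (m s))"
      using \<xi>(2)[of ?z "\<lambda>z. k (f z ?a)"] B(3) s by (simp add: m_def N_def)
    also have "\<dots> = frechet_derivative K (at (m s, s)) (\<xi> (m s), 0)"
      using frechet_derivative_eqI[OF has_derivative_partial_fst[OF K'[of "(m s, s)"]]] A(3) s T(3)
      by (auto simp: K_def N_def)
    finally show ?thesis by (simp add: Q_def)
  qed
  \<comment> \<open>At \<open>s0\<close> the group element is the identity, so
    \<open>Q (u, s0)\<close> is \<open>\<delta> k\<close> in coordinates, and composing with
    \<open>m\<close> follows \<open>\<delta> k\<close> along the points
    \<open>f y (inv (chart_inv c0 s))\<close>. The sign comes from \<open>gen_inv\<close>.\<close>
  have R: "Q' (m' \<tau>, 0) = - gen \<tau> (\<delta> k) y" for \<tau>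
  proof -
    have d1: "((\<lambda>u. Q (u, s0)) has_derivative (\<lambda>v. Q' (v, 0))) (at u0)"
      by (rule has_derivative_partial_fst[OF Q'])
    obtain W where W: "openin (mtop X) W" "y \<in> W" "\<And>z. z \<in> W \<Longrightarrow> smooth_at X euc k z"
      using smooth_at_eventually[OF k] by blast
    let ?V = "(\<lambda>u. (u, s0)) -` T \<inter> snd e ` (fst e \<inter> W)"
    have V: "open ?V" "u0 \<in> ?V"
      using T(1,2) chartedD(3)[OF charted_space e(1) W(1)] e(2) W(2)
      by (auto simp: u0_def intro!: open_Int open_vimage continuous_intros)
    have "Q (u, s0) = \<delta> k (chart_inv e u)" if uV: "u \<in> ?V" for u
    proof -
      obtain z where z: "u = snd e z" "z \<in> fst e" "z \<in> W" using uV by auto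
      have u: "chart_inv e u = z" using charted_inv[OF charted_space e(1) z(2)] z(1) by simp
      have p: "(u, s0) \<in> U" using uV T(3) by auto
      have "((\<lambda>u. k (chart_inv e u)) has_derivative (\<lambda>v. frechet_derivative K (at (u, s0)) (v, 0))) (at u)"
      proof (rule has_derivative_transform_within_open[OF has_derivative_partial_fst[OF K'[OF p]] V(1) uV])
        fix x assume "x \<in> ?V"
        then have "chart_inv e x \<in> S"
          using chartedD(5)[OF charted_space e(1) inv_into_into[of x "snd e" "fst e"]] by blast
        then show "K (x, s0) = k (chart_inv e x)" by (simp add: K_def c0_one act_one)
      qed
      from frechet_derivative_eqI[OF this] show ?thesis
        using \<xi>(2)[OF z(2) W(3)[OF z(3)]] unfolding u by (simp add: Q_def z(1))
    qed
    from has_derivative_transform_within_open[OF d1 V this]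
    have d2: "((\<lambda>u. \<delta> k (chart_inv e u)) has_derivative (\<lambda>v. Q' (v, 0))) (at (m s0))"
      by (simp add: m0)
    have "((\<lambda>s. \<delta> k (chart_inv e (m s))) has_derivative (\<lambda>w. Q' (m' w, 0))) (at s0)"
      by (rule has_derivative_compose[OF m' d2])
    then have "((\<lambda>s. \<delta> k (f y (inv (chart_inv c0 s)))) has_derivative (\<lambda>w. Q' (m' w, 0))) (at s0)"
      by (rule has_derivative_transform_within_open[OF _ N]) (simp add: em)
    from frechet_derivative_eqI[OF this, of \<tau>] show ?thesis
      using gen_inv[OF vector_field_smooth[OF charted_space \<delta>(1) k], of \<tau>] by simp
  qed
  \<comment> \<open>Only \<open>s\<close> varies here, so \<open>\<xi>\<close> can be frozen at
    \<open>u0\<close>. Then \<open>Q (u0, s)\<close> is a derivative of \<open>K\<close> in a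
    constant direction, as the symmetry of second derivatives requires.\<close>
  have L: "Q' (0, \<tau>) = \<delta> (gen \<tau> k) y" for \<tau>
  proof -
    let ?R = "\<lambda>p. frechet_derivative K (at p) (\<xi> u0, 0)"
    have "(?R has_derivative frechet_derivative ?R (at (u0, s0))) (at (u0, s0))"
      by (rule smooth_on_has_derivative[OF smooth_on_frechet[OF U(3)] U(2)])
    from has_derivative_partial_snd[OF this]
    have "((\<lambda>s. Q (u0, s)) has_derivative (\<lambda>v. frechet_derivative ?R (at (u0, s0)) (0, v))) (at s0)"
      by (simp add: Q_def)
    with has_derivative_partial_snd[OF Q']
    have "Q' (0, \<tau>) = frechet_derivative ?R (at (u0, s0)) (0, \<tau>)"
      using has_derivative_unique by metis
    also have "\<dots> = frechet_derivative (\<lambda>p. frechet_derivative K (at p) (0, \<tau>)) (at (u0, s0)) (\<xi> u0, 0)"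
      by (rule frechet_derivative_symmetric[OF _ U(1,2)]) (use U(3) in \<open>simp add: smooth_on_def\<close>)
    also have "\<dots> = \<delta> (gen \<tau> k) y"
    proof -
      have d3: "((\<lambda>u. frechet_derivative K (at (u, s0)) (0, \<tau>)) has_derivative
        (\<lambda>v. frechet_derivative (\<lambda>p. frechet_derivative K (at p) (0, \<tau>)) (at (u0, s0)) (v, 0))) (at u0)"
        by (rule has_derivative_partial_fst[OF smooth_on_has_derivative[OF smooth_on_frechet[OF U(3)] U(2)]])
      have op: "open ((\<lambda>u. (u, s0)) -` U)" using U(1) by (intro open_vimage continuous_intros)
      have "frechet_derivative K (at (u, s0)) (0, \<tau>) = gen \<tau> k (chart_inv e u)"
        if "u \<in> (\<lambda>u. (u, s0)) -` U" for u
        using frechet_derivative_eqI[OF has_derivative_partial_snd[OF K'[of "(u, s0)"]], of \<tau>] that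
        by (simp add: gen_eq K_def)
      from has_derivative_transform_within_open[OF d3 op _ this]
      have "((\<lambda>u. gen \<tau> k (chart_inv e u)) has_derivative
        (\<lambda>v. frechet_derivative (\<lambda>p. frechet_derivative K (at p) (0, \<tau>)) (at (u0, s0)) (v, 0))) (at u0)"
        using U(2) by simp
      from frechet_derivative_eqI[OF this, of "\<xi> u0"] show ?thesis
        using \<xi>(2)[OF e(2) gen_smooth[OF k, of \<tau>]] by (simp add: u0_def)
    qed
    finally show ?thesis .
  qed
  obtain W where W: "smooth_fun_on X W k" "y \<in> W" by (rule smooth_at_nbhd[OF charted_space k])
  have lin: "linear (\<lambda>w. Q' (m' w, w))" by (rule has_derivative_linear[OF QD])
  have "Q' (m' \<tau>, \<tau>) = 0" if "\<tau> \<in> Basis" for \<tau>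
  proof -
    have "bracket \<delta> (gen \<tau>) k y = 0" using \<delta>(2)[OF that] W unfolding vf_commute_def by blast
    then show ?thesis
      using linear_Pair_split[OF has_derivative_linear[OF Q'], of "m' \<tau>" \<tau>] R L by (simp add: bracket_def)
  qed
  \<comment> \<open>The commutation is assumed along \<open>Basis\<close> only; linearity extends it
    to every direction.\<close>
  then have "Q' (m' w, w) = 0" for w using linear_euclidean_expand[OF lin, of w] by simp
  then have "((\<lambda>s. Q (m s, s)) has_derivative (\<lambda>w. 0)) (at s0)" using QD by simp
  then show ?thesis by (rule has_derivative_transform_within_open[OF _ N]) (rule FQ)
qed

lemma reciprocal_invariant:
  assumes \<delta>: "vector_field X \<delta>" "\<And>\<tau>. \<tau> \<in> Basis \<Longrightarrow> vf_commute X \<delta> (gen \<tau>)"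
    and conn: "connected_space (mtop GM)"
    and x: "x \<in> S" and a: "a \<in> carrier G" and h: "smooth_at X euc h (f x a)"
  shows "\<delta> (\<lambda>z. h (f z a)) x = \<delta> h (f x a)"
proof -
  define x' where "x' = f x a"
  have x': "x' \<in> S" "f x' (inv a) = x" "smooth_at X euc h x'"
    using x a h by (auto simp: x'_def act_closed act_mult act_one)
  define F where "F b = \<delta> (\<lambda>z. h (f z b)) (f x' (inv b))" for b
  have der: "((\<lambda>t. F (chart_inv d t)) has_derivative (\<lambda>v. 0)) (at t)"
    if d: "d \<in> atlas GM" and t: "t \<in> snd d ` fst d" for d t
  proof -
    define a0 where "a0 = chart_inv d t"
    have a0: "a0 \<in> carrier G" unfolding a0_def by (rule chart_carrier[OF d inv_into_into[OF t]])
    define y where "y = f x' (inv a0)"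
    have y: "y \<in> S" "f y a0 = x'" using x' a0 by (auto simp: y_def act_closed act_mult act_one)
    define k where "k z = h (f z a0)" for z
    have k: "smooth_at X euc k y"
      unfolding k_def by (rule smooth_at_translate[OF y(1) a0]) (simp add: y x')
    \<comment> \<open>Recentres the parameters around \<open>a0\<close> at the identity, where
      \<open>transport_derivative_zero\<close> applies. Translation by
      \<open>g = chart_inv d t'\<close> is translation by \<open>b t'\<close> followed by
      translation by \<open>a0\<close>, and \<open>k\<close> absorbs the latter.\<close>
    define b where "b t' = inv a0 \<otimes> chart_inv d t'" for t'
    have bt: "b t = \<one>" using a0 by (simp add: b_def a0_def)
    have b: "smooth_at euc GM b t"
      unfolding b_def using a0
      by (intro smooth_at_mult smooth_at_const smooth_at_chart_inv[OF charted_group d t])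
        (auto simp: charted_group topspace_group)
    have "smooth_at euc euc (\<lambda>t. snd c0 (b t)) t"
      by (rule smooth_at_compose'[OF charted_euc charted_group charted_euc b
            smooth_at_chart[OF charted_group c0] bt])
    then obtain r' where r': "((\<lambda>t. snd c0 (b t)) has_derivative r') (at t)"
      using smooth_at_euc_derivative by blast
    obtain V where V: "open V" "t \<in> V" "\<And>t'. t' \<in> V \<Longrightarrow> b t' \<in> fst c0"
      using smooth_at_open[OF charted_euc charted_group b chartedD(1)[OF charted_group c0(1)]] c0(2) bt
      by auto
    let ?\<Phi> = "\<lambda>s. \<delta> (\<lambda>z. k (f z (chart_inv c0 s))) (f y (inv (chart_inv c0 s)))"
    \<comment> \<open>In the chain rule the outer derivative already vanishes, so the value of the
      inner derivative \<open>r'\<close> is immaterial.\<close>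
    have "((\<lambda>t. ?\<Phi> (snd c0 (b t))) has_derivative (\<lambda>v. 0)) (at t)"
      by (rule has_derivative_compose[where g = ?\<Phi> and g' = "\<lambda>w. 0", OF r'])
        (simp add: bt transport_derivative_zero[OF \<delta> k])
    then show ?thesis
    proof (rule has_derivative_transform_within_open)
      show "open (V \<inter> snd d ` fst d)" "t \<in> V \<inter> snd d ` fst d"
        using V t charted_open_range[OF charted_group d] by auto
      fix t' assume t': "t' \<in> V \<inter> snd d ` fst d"
      define g where "g = chart_inv d t'"
      have g: "g \<in> carrier G" unfolding g_def using t' by (intro chart_carrier[OF d inv_into_into]) auto
      have bg: "b t' = inv a0 \<otimes> g" by (simp add: b_def g_def)
      have c: "chart_inv c0 (snd c0 (b t')) = inv a0 \<otimes> g"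
        unfolding bg[symmetric] using V(3) t' by (intro charted_inv[OF charted_group c0(1)]) auto
      have pt: "f y (inv (inv a0 \<otimes> g)) = f x' (inv g)"
        using x' a0 g by (simp add: y_def act_mult inv_mult_group m_assoc)
      have gx: "f x' (inv g) \<in> S" "f (f x' (inv g)) g = x'"
        using x' g by (auto simp: act_closed act_mult act_one)
      \<comment> \<open>The action laws hold on \<open>S\<close> only, so the two functions agree
        there and not as total functions; hence the passage through
        \<open>vector_field_cong\<close>.\<close>
      have agree: "h (f z g) = k (f z (inv a0 \<otimes> g))" if "z \<in> S" for z
        using that a0 g by (simp add: k_def act_mult m_assoc[symmetric])
      have "\<delta> (\<lambda>z. h (f z g)) (f x' (inv g)) = \<delta> (\<lambda>z. k (f z (inv a0 \<otimes> g))) (f x' (inv g))"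
        by (rule vector_field_cong[OF charted_space \<delta>(1) smooth_at_translate[OF gx(1) g]
              openin_topspace gx(1)]) (simp_all add: gx x' agree)
      then show "?\<Phi> (snd c0 (b t')) = F (chart_inv d t')"
        by (simp add: F_def c pt g_def[symmetric])
    qed
  qed
  \<comment> \<open>The base point \<open>f x' (inv b)\<close> is \<open>x\<close> for
    \<open>b = a\<close> and \<open>x'\<close> for the identity, so these two values are the two
    sides of the claim.\<close>
  have "F a = F \<one>"
    by (rule constant_if_derivative_zero[OF charted_group conn der]) (auto simp: topspace_group a)
  moreover have "\<delta> h x' = \<delta> (\<lambda>z. h (f z \<one>)) x'"
    by (rule vector_field_cong[OF charted_space \<delta>(1) x'(3) openin_topspace x'(1)]) (simp add: act_one)
  ultimately show ?thesis
    by (simp add: F_def x' act_one) (simp add: x'_def)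
qed

end

section \<open>The parameter map of a principal homogeneous space\<close>

context smooth_action
begin

context
  assumes graph: "diffeomorphism (prod_mfd X GM) (prod_mfd X X) (action_graph f)"
begin

lemma parameter_map_closed:
  assumes "x \<in> S" "y \<in> S"
  shows "parameter_map G X f (x, y) \<in> carrier G" "f x (parameter_map G X f (x, y)) = y"
proof -
  have "(x, y) \<in> action_graph f ` (S \<times> carrier G)"
    using graph assms by (simp add: diffeomorphism_def bij_betw_def topspace_group)
  then have i: "inv_into (S \<times> carrier G) (action_graph f) (x, y) \<in> S \<times> carrier G"
    "action_graph f (inv_into (S \<times> carrier G) (action_graph f) (x, y)) = (x, y)"
    by (rule inv_into_into, rule f_inv_into_f)
  show "parameter_map G X f (x, y) \<in> carrier G" "f x (parameter_map G X f (x, y)) = y"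
    using i by (auto simp: parameter_map_def action_graph_def split: prod.splits)
qed

lemma parameter_map_act:
  assumes "x \<in> S" "a \<in> carrier G"
  shows "parameter_map G X f (x, f x a) = a"
proof -
  have "inv_into (S \<times> carrier G) (action_graph f) (action_graph f (x, a)) = (x, a)"
    using graph assms by (intro inv_into_f_f) (auto simp: diffeomorphism_def bij_betw_def topspace_group)
  then show ?thesis by (simp add: parameter_map_def action_graph_def)
qed

text \<open>It is the second component of the inverse of the graph, which is smooth since the graph
  is a diffeomorphism.\<close>

lemma smooth_at_parameter_map:
  assumes p: "p \<in> S \<times> S"
  shows "smooth_at (prod_mfd X X) GM (parameter_map G X f) p"
proof -
  note PX = charted_prod[OF charted_space charted_space]
    and PG = charted_prod[OF charted_space charted_group]
  let ?i = "inv_into (S \<times> carrier G) (action_graph f)"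
  have i: "smooth_at (prod_mfd X X) (prod_mfd X GM) ?i p"
    using graph p smooth_map_iff[OF PX PG] by (auto simp: diffeomorphism_def topspace_group)
  then have "?i p \<in> S \<times> topspace (mtop GM)" using smooth_at_topspace(2)[OF PX PG] by fastforce
  from smooth_at_compose[OF PX PG charted_group i smooth_at_snd[OF charted_space charted_group this]]
  show ?thesis by (simp add: parameter_map_def[abs_def])
qed

lemma connected_group:
  assumes "connected_space (mtop X)" "S \<noteq> {}"
  shows "connected_space (mtop GM)"
proof -
  obtain x where x: "x \<in> S" using assms by blast
  have "smooth_at X GM (\<lambda>y. parameter_map G X f (x, y)) y" if "y \<in> S" for y
    by (rule smooth_at_compose'[OF charted_space charted_prod[OF charted_space charted_space] charted_group
          smooth_at_Pair[OF charted_space charted_space charted_space smooth_at_const smooth_at_ident]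
          smooth_at_parameter_map[of "(x, y)"]]) (use x that charted_space in auto)
  then have "smooth_map X GM (\<lambda>y. parameter_map G X f (x, y))"
    using smooth_map_iff[OF charted_space charted_group] by blast
  then have c: "continuous_map (mtop X) (mtop GM) (\<lambda>y. parameter_map G X f (x, y))"
    by (simp add: smooth_map_def)
  \<comment> \<open>Surjectivity: the group element \<open>a\<close> is the parameter of the point
    \<open>y = f x a\<close>.\<close>
  have "(\<lambda>y. parameter_map G X f (x, y)) ` S = carrier G"
  proof (intro subset_antisym subsetI)
    fix a assume "a \<in> carrier G"
    then show "a \<in> (\<lambda>y. parameter_map G X f (x, y)) ` S"
      using parameter_map_act[OF x] act_closed[OF x] by (metis imageI)
  qed (use parameter_map_closed(1)[OF x] in auto)
  then show ?thesis
    using connectedin_continuous_map_image[OF c, of S] assms(1)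
    by (simp add: connectedin_topspace topspace_group[symmetric])
qed

end

end

lemma (in smooth_action_at_one) constant_for_parameter:
  assumes graph: "diffeomorphism (prod_mfd X GM) (prod_mfd X X) (action_graph f)"
    and conn: "connected_space (mtop X)" and c: "c \<in> atlas GM"
  shows "constant_for X (reciprocal_distribution G c0 X f)
    {p \<in> S \<times> S. parameter_map G X f p \<in> fst c} (\<lambda>p. snd c (parameter_map G X f p) \<bullet> \<tau>)"
proof -
  let ?\<phi> = "parameter_map G X f"
  let ?W = "{p \<in> S \<times> S. ?\<phi> p \<in> fst c}"
  let ?h = "\<lambda>p. snd c (?\<phi> p) \<bullet> \<tau>"
  note PX = charted_prod[OF charted_space charted_space]
  note sm\<phi> = smooth_at_parameter_map[OF graph]
  have "smooth_map (prod_mfd X X) GM ?\<phi>" using smooth_map_iff[OF PX charted_group] sm\<phi> by auto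
  then have "openin (mtop (prod_mfd X X)) {p \<in> topspace (mtop (prod_mfd X X)). ?\<phi> p \<in> fst c}"
    unfolding smooth_map_def using openin_continuous_map_preimage chartedD(1)[OF charted_group c] by blast
  then have W: "openin (mtop (prod_mfd X X)) ?W" by simp
  have h: "smooth_at (prod_mfd X X) euc ?h p" if "p \<in> ?W" for p
  proof -
    have "smooth_at (prod_mfd X X) euc (\<lambda>p. snd c (?\<phi> p)) p"
      using that by (intro smooth_at_compose[OF PX charted_group charted_euc sm\<phi>
            smooth_at_chart[OF charted_group c]]) auto
    from smooth_at_compose[OF PX charted_euc charted_euc this
        smooth_at_euc_linear[OF bounded_linear_inner_left[of \<tau>]]] show ?thesis .
  qed
  have "extend_vf \<delta> ?h p = 0" if \<delta>: "\<delta> \<in> reciprocal_distribution G c0 X f" and pW: "p \<in> ?W" for \<delta> p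
  proof -
    have vf: "vector_field X \<delta>" "\<And>\<tau>. \<tau> \<in> Basis \<Longrightarrow> vf_commute X \<delta> (gen \<tau>)"
      using \<delta> by (auto simp: reciprocal_distribution_def)
    obtain x y where p: "p = (x, y)" and x: "x \<in> S" and y: "y \<in> S" and xy: "?\<phi> (x, y) \<in> fst c"
      using pW by auto
    \<comment> \<open>The point of \<open>?W\<close> under consideration supplies the base point
      that \<open>connected_group\<close> asks for.\<close>
    have connG: "connected_space (mtop GM)" using connected_group[OF graph conn] x by blast
    define a where "a = ?\<phi> (x, y)"
    have a: "a \<in> carrier G" "f x a = y" using parameter_map_closed[OF graph x y] by (auto simp: a_def)
    \<comment> \<open>Translating the second variable by \<open>a\<close> pulls
      \<open>(x, y)\<close> back to the diagonal point \<open>(x, x)\<close>, where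
      \<open>vector_field_diagonal\<close> applies.\<close>
    define H where "H = (\<lambda>q. ?h (fst q, f (snd q) a))"
    have snd': "smooth_at (prod_mfd X X) X (\<lambda>q. f (snd q) a) (x, x)"
      using x a by (intro smooth_at_act[OF PX] smooth_at_snd smooth_at_const)
        (auto simp: charted_space charted_group topspace_group)
    have "smooth_at (prod_mfd X X) (prod_mfd X X) (\<lambda>q. (fst q, f (snd q) a)) (x, x)"
      by (rule smooth_at_Pair[OF PX charted_space charted_space smooth_at_fst snd'])
        (use x charted_space in auto)
    from smooth_at_compose'[OF PX PX charted_euc this h[OF pW]]
    have H: "smooth_at (prod_mfd X X) euc H (x, x)" by (simp add: H_def p a)
    have "smooth_at X (prod_mfd X X) (\<lambda>z. (x, z)) y"
      using x y by (intro smooth_at_Pair smooth_at_const smooth_at_ident) (auto simp: charted_space)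
    from smooth_at_compose'[OF charted_space PX charted_euc this h[OF pW]]
    have hy: "smooth_at X euc (\<lambda>z. ?h (x, z)) (f x a)" by (simp add: p a)
    \<comment> \<open>Invariance enters here: it carries the summand taken at \<open>y\<close> to
      the point \<open>x\<close>, where the other summand lives.\<close>
    have "\<delta> (\<lambda>z. ?h (x, z)) y = \<delta> (\<lambda>z. H (x, z)) x"
      using reciprocal_invariant[OF vf connG x a(1) hy] by (simp add: H_def a)
    moreover have "\<delta> (\<lambda>z. H (z, x)) x = \<delta> (\<lambda>z. ?h (z, y)) x" by (simp add: H_def a)
    moreover have "\<delta> (\<lambda>z. H (z, z)) x = 0"
    proof -
      have "\<delta> (\<lambda>z. snd c a \<bullet> \<tau>) x = \<delta> (\<lambda>z. H (z, z)) x"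
        by (rule vector_field_cong[OF charted_space vf(1)
              smooth_at_const[OF charted_space charted_euc x] openin_topspace x])
          (use a in \<open>simp_all add: H_def parameter_map_act[OF graph]\<close>)
      then show ?thesis by (simp add: vector_field_const[OF charted_space vf(1) x])
    qed
    ultimately show ?thesis
      using vector_field_diagonal[OF charted_space vf(1) H] by (simp add: extend_vf_def p)
  qed
  then show ?thesis
    using W h smooth_fun_on_iff[OF PX] by (simp add: constant_for_def)
qed

section \<open>A Lie group acting on itself by left translations\<close>

lemma (in smooth_group) left_translation_action:
  "group_action G (carrier G) (\<lambda>a. restrict (\<lambda>x. a \<otimes> x) (carrier G))"
proof -
  let ?L = "\<lambda>a. restrict (\<lambda>x. a \<otimes> x) (carrier G)"
  have bij: "?L a \<in> Bij (carrier G)" if "a \<in> carrier G" for a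
    unfolding Bij_def
  proof (intro IntI CollectI)
    have "bij_betw (\<lambda>x. a \<otimes> x) (carrier G) (carrier G)"
      by (rule bij_betw_byWitness[of _ "\<lambda>x. inv a \<otimes> x"]) (use that in \<open>auto simp: m_assoc[symmetric]\<close>)
    then show "bij_betw (?L a) (carrier G) (carrier G)"
      by (rule bij_betw_cong[THEN iffD1, rotated]) simp
  qed simp
  have "?L \<in> hom G (BijGroup (carrier G))"
  proof (rule homI)
    fix a b assume ab: "a \<in> carrier G" "b \<in> carrier G"
    show "?L (a \<otimes> b) = ?L a \<otimes>\<^bsub>BijGroup (carrier G)\<^esub> ?L b"
      using ab bij by (auto simp: BijGroup_def compose_def m_assoc fun_eq_iff)
  qed (simp add: BijGroup_def bij)
  then show ?thesis
    unfolding group_action_def group_hom_def group_hom_axioms_def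
    by (simp add: is_group group_BijGroup)
qed

text \<open>The equation \<open>y = a \<otimes> x\<close> has the solution
  \<open>a = y \<otimes> inv x\<close>, so the inverse of the graph is explicit, and it is smooth
  because multiplication and inversion are.\<close>

lemma (in smooth_group) principal_left_translation:
  "principal_homogeneous_space G GM GM (\<lambda>x a. a \<otimes> x)"
proof -
  note CG = charted_group and P = charted_prod[OF charted_group charted_group]
  let ?C = "carrier G \<times> carrier G"
  let ?g = "action_graph (\<lambda>x a. a \<otimes> x)"
  have fst: "smooth_at (prod_mfd GM GM) GM fst p" and snd: "smooth_at (prod_mfd GM GM) GM snd p"
    if "p \<in> ?C" for p
    using that by (auto intro: smooth_at_fst[OF CG CG] smooth_at_snd[OF CG CG] simp: topspace_group)
  have act: "smooth_map (prod_mfd GM GM) GM (\<lambda>(x, a). a \<otimes> x)"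
    using smooth_at_mult[OF P snd fst] by (simp add: smooth_map_iff[OF P CG] topspace_group case_prod_unfold)
  have graph: "smooth_map (prod_mfd GM GM) (prod_mfd GM GM) ?g"
    using smooth_at_Pair[OF P CG CG fst smooth_at_mult[OF P snd fst]]
    by (simp add: smooth_map_iff[OF P P] topspace_group case_prod_unfold action_graph_def)
  have bij: "bij_betw ?g ?C ?C"
    by (rule bij_betw_byWitness[of _ "\<lambda>(x, y). (x, y \<otimes> inv x)"])
      (auto simp: action_graph_def m_assoc)
  \<comment> \<open>The choice function \<open>inv_into\<close> follows the formula on
    \<open>?C\<close> only. As \<open>?C\<close> is the whole space of the product manifold,
    smoothness of the formula still transfers to it.\<close>
  have inverse: "inv_into ?C ?g p = (fst p, snd p \<otimes> inv (fst p))" if "p \<in> ?C" for p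
    using that bij by (intro inv_into_f_eq) (auto simp: bij_betw_def action_graph_def m_assoc)
  have "smooth_at (prod_mfd GM GM) (prod_mfd GM GM) (\<lambda>p. (fst p, snd p \<otimes> inv (fst p))) p"
    if "p \<in> ?C" for p
    by (rule smooth_at_Pair[OF P CG CG fst[OF that] smooth_at_mult[OF P snd[OF that] smooth_at_inv[OF P fst[OF that]]]])
  from smooth_at_cong[OF P this openin_topspace]
  have "smooth_at (prod_mfd GM GM) (prod_mfd GM GM) (inv_into ?C ?g) p" if "p \<in> ?C" for p
    using that inverse by (simp add: topspace_group)
  then have "smooth_map (prod_mfd GM GM) (prod_mfd GM GM) (inv_into ?C ?g)"
    by (simp add: smooth_map_iff[OF P P] topspace_group)
  then show ?thesis
    using act graph bij left_translation_action
    by (simp add: principal_homogeneous_space_def lie_action_def diffeomorphism_def topspace_group)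
qed

text \<open>A group parameter is a coordinate in a chart \<open>c\<close>, hence a function only
  where the parameter map takes values in the domain of \<open>c\<close>; this dictates the open set
  of pairs. The chart \<open>c\<^sub>0\<close> fixes the parameters in which the generators are
  taken and is independent of \<open>c\<close>.\<close>

theorem theorem3p1:
  fixes G :: "'g monoid" and GM :: "('g, 'p::euclidean_space) mfd"
    and X :: "('x, 'e::euclidean_space) mfd" and f :: "'x \<Rightarrow> 'g \<Rightarrow> 'x"
    and c\<^sub>0 :: "('g, 'p) chart"
  assumes "lie_group G GM" and "c\<^sub>0 \<in> atlas GM" and "\<one>\<^bsub>G\<^esub> \<in> fst c\<^sub>0"
  shows "(smooth_manifold X \<and> connected_space (mtop X) \<and> principal_homogeneous_space G GM X f \<longrightarrow>
            (\<forall>c\<in>atlas GM. \<forall>\<tau>\<in>Basis.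
               constant_for X (reciprocal_distribution G c\<^sub>0 X f)
                 {p \<in> topspace (mtop X) \<times> topspace (mtop X). parameter_map G X f p \<in> fst c}
                 (\<lambda>p. snd c (parameter_map G X f p) \<bullet> \<tau>)))
         \<and> principal_homogeneous_space G GM GM (\<lambda>x a. a \<otimes>\<^bsub>G\<^esub> x)"
proof -
  interpret smooth_group G GM by unfold_locales fact
  have "constant_for X (reciprocal_distribution G c\<^sub>0 X f)
      {p \<in> topspace (mtop X) \<times> topspace (mtop X). parameter_map G X f p \<in> fst c}
      (\<lambda>p. snd c (parameter_map G X f p) \<bullet> \<tau>)"
    if X: "smooth_manifold X" "connected_space (mtop X)" "principal_homogeneous_space G GM X f"
      and c: "c \<in> atlas GM" for c \<tau>
  proof -
    have "lie_action G GM X f" and graph: "diffeomorphism (prod_mfd X GM) (prod_mfd X X) (action_graph f)"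
      using X(3) by (auto simp: principal_homogeneous_space_def)
    then interpret smooth_action_at_one G GM X f c\<^sub>0
      by unfold_locales (use X assms in \<open>auto intro: smooth_manifold_charted\<close>)
    show ?thesis by (rule constant_for_parameter[OF graph X(2) c])
  qed
  then show ?thesis using principal_left_translation by blast
qed

end
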